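(* Fix $c\in(0,2)$. There exist constants $C>0$ and $\kappa_0>1$, depending only on $c$, such that the following holds. Let $A\in\mathbb{R}^{n\times d}$ with $\lambda_{\min}>0$ and condition number $\kappa\ge\kappa_0$, let $b\in\mathbb{R}^n$, suppose the minimizer $x^*$ of $f(x)=\frac12\|Ax-b\|^2$ satisfies $Ax^*=b$, and let the sampling probabilities $p_1,\dots,p_n$ satisfy $\eta p_j\ge \|a_j\|^2/\|A\|_F^2$ for $j=1,\dots,n$, for some $\eta\ge 1$. Then there exist constant parameters $\alpha$ and $\beta$ such that, for every batch size $B$ with $$B\ge C\,\eta\, d\log(d)\,\bar\kappa\sqrt{\kappa},$$ the Minibatch-HBM iterates with step-size $\alpha$, momentum $\beta$ and batch size $B$ converge in expected norm at least at the linear rate $1-c/\sqrt{\kappa}$; that is, there is a finite constant $K$ independent of $k$ and $x_0$ such that for all $x_0\in\mathbb{R}^d$ and all integers $k>0$, $$\mathbb{E}\big[\|x_k-x^*\|\big]\le K\left(1-\frac{c}{\sqrt{\kappa}}\right)^k\|x_0-x^*\|.$$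
   Context: $\|\cdot\|$ is the Euclidean norm of vectors, $\|\cdot\|_F$ the Frobenius norm; $\log$ is the natural logarithm. $a_j^{\mathsf T}$ denotes the $j$th row of $A$ and $b_j$ the $j$th entry of $b$. $\lambda_{\max},\lambda_{\min},\lambda_{\mathrm{ave}}$ are the largest, smallest and average of the $d$ eigenvalues of $A^{\mathsf T}A$ (so $\lambda_{\min}>0$ means $f$ is strongly convex); $\kappa=\lambda_{\max}/\lambda_{\min}$ and $\bar\kappa=\lambda_{\mathrm{ave}}/\lambda_{\min}$. Sampling: $p_1,\dots,p_n>0$ with $\sum_j p_j=1$. For each $k\ge1$, $S_k$ is a list of $B$ indices drawn independently with replacement from $\{1,\dots,n\}$, where each draw equals $j$ with probability $p_j$; the lists $S_1,S_2,\dots$ are independent. The minibatch stochastic gradient is $$\nabla f_{S_k}(x)=\frac1B\sum_{j\in S_k}\frac1{p_j}a_j(a_j^{\mathsf T}x-b_j).$$ Minibatch-HBM (minibatch heavy ball momentum) with constant parameters $\alpha,\beta$ and batch size $B$: given a deterministic $x_0$, set $x_1=x_0$ and for $k\ge1$ $$x_{k+1}=x_k-\alpha\nabla f_{S_k}(x_k)+\beta(x_k-x_{k-1}).$$ *)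

theory Defs
  imports "HOL-Probability.Probability" "Jordan_Normal_Form.Char_Poly"
begin

text \<open>
  The dimensions \<open>n\<close>, \<open>d\<close> have to be quantified below constants that do not depend on them, so
  vectors and matrices are those of \<open>Jordan_Normal_Form\<close>, with explicit carriers. The rows of a
  matrix and the sampled indices run over \<open>{..<n}\<close> instead of \<open>{1..n}\<close>.
\<close>

definition euclid_norm :: "real Matrix.vec \<Rightarrow> real" where
  "euclid_norm v = sqrt (scalar_prod v v)"

definition frobenius_norm :: "real mat \<Rightarrow> real" where
  "frobenius_norm A = sqrt (\<Sum>i<dim_row A. \<Sum>j<dim_col A. (A $$ (i, j))\<^sup>2)"

text \<open>
  The eigenvalues of \<open>A\<^sup>T A\<close>, repeated according to algebraic multiplicity. As \<open>A\<^sup>T A\<close> is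
  symmetric, its characteristic polynomial splits over the reals and there are \<open>dim_col A\<close> of them.
\<close>
definition gram_eigenvalues :: "real mat \<Rightarrow> real multiset" where
  "gram_eigenvalues A = proots (char_poly (transpose_mat A * A))"

definition lambda_max :: "real mat \<Rightarrow> real" where
  "lambda_max A = Max_mset (gram_eigenvalues A)"

definition lambda_min :: "real mat \<Rightarrow> real" where
  "lambda_min A = Min_mset (gram_eigenvalues A)"

definition lambda_ave :: "real mat \<Rightarrow> real" where
  "lambda_ave A = sum_mset (gram_eigenvalues A) / real (dim_col A)"

definition cond_num :: "real mat \<Rightarrow> real" where
  "cond_num A = lambda_max A / lambda_min A"

definition ave_cond_num :: "real mat \<Rightarrow> real" where
  "ave_cond_num A = lambda_ave A / lambda_min A"

definition lsq :: "real mat \<Rightarrow> real Matrix.vec \<Rightarrow> real Matrix.vec \<Rightarrow> real" where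
  "lsq A b x = 1 / 2 * (euclid_norm (A *\<^sub>v x - b))\<^sup>2"

text \<open>
  The sampling probabilities are \<open>p\<^sub>j = pmf p j\<close>; for matrices with \<open>n\<close> rows, \<open>p\<close> has support
  \<open>{..<n}\<close>. The batch size is the length of the list \<open>S\<close>.
\<close>
definition batch_grad ::
  "real mat \<Rightarrow> real Matrix.vec \<Rightarrow> nat pmf \<Rightarrow> nat list \<Rightarrow> real Matrix.vec \<Rightarrow> real Matrix.vec" where
  "batch_grad A b p S x =
     (1 / real (length S)) \<cdot>\<^sub>v
       foldr (+)
         (map (\<lambda>j. (1 / pmf p j * (scalar_prod (Matrix.row A j) x - vec_index b j)) \<cdot>\<^sub>v Matrix.row A j) S)
         (0\<^sub>v (dim_col A))"

text \<open>The iterates \<open>x\<^sub>k\<close> for a given sequence \<open>S\<close> of batches; the entry \<open>S 0\<close> is never used.\<close>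
fun hbm ::
  "real mat \<Rightarrow> real Matrix.vec \<Rightarrow> nat pmf \<Rightarrow> real \<Rightarrow> real \<Rightarrow> real Matrix.vec \<Rightarrow>
   (nat \<Rightarrow> nat list) \<Rightarrow> nat \<Rightarrow> real Matrix.vec" where
  "hbm A b p \<alpha> \<beta> x0 S 0 = x0"
| "hbm A b p \<alpha> \<beta> x0 S (Suc 0) = x0"
| "hbm A b p \<alpha> \<beta> x0 S (Suc (Suc k)) =
     hbm A b p \<alpha> \<beta> x0 S (Suc k)
     - \<alpha> \<cdot>\<^sub>v batch_grad A b p (S (Suc k)) (hbm A b p \<alpha> \<beta> x0 S (Suc k))
     + \<beta> \<cdot>\<^sub>v (hbm A b p \<alpha> \<beta> x0 S (Suc k) - hbm A b p \<alpha> \<beta> x0 S k)"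

text \<open>The law of a sequence of independent batches, each consisting of \<open>B\<close> independent draws from \<open>p\<close>.\<close>
definition batches :: "nat \<Rightarrow> nat pmf \<Rightarrow> (nat \<Rightarrow> nat list) measure" where
  "batches B p = PiM UNIV (\<lambda>_. measure_pmf (replicate_pmf B p))"

text \<open>
  A Bochner integral is \<open>0\<close> for functions that are not integrable; the following shows that this
  default does not matter for expectations of functions of the iterates.
\<close>

lemma hbm_cong:
  "(\<And>i. i < k \<Longrightarrow> S i = S' i) \<Longrightarrow> hbm A b p \<alpha> \<beta> x0 S k = hbm A b p \<alpha> \<beta> x0 S' k"
  by (induction A b p \<alpha> \<beta> x0 S k rule: hbm.induct) simp_all

lemma integrable_hbm:
  fixes f :: "real Matrix.vec \<Rightarrow> real"
  assumes fin: "finite (set_pmf p)"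
  shows "integrable (batches B p) (\<lambda>S. f (hbm A b p \<alpha> \<beta> x0 S k))"
proof -
  let ?M = "batches B p" and ?q = "replicate_pmf B p"
  let ?pre = "\<lambda>S::nat \<Rightarrow> nat list. map S [0..<k]"
  define g where "g = (\<lambda>xs. f (hbm A b p \<alpha> \<beta> x0 (\<lambda>i. xs ! i) k))"
  have eq: "(\<lambda>S. f (hbm A b p \<alpha> \<beta> x0 S k)) = (\<lambda>S. g (?pre S))"
    unfolding g_def by (intro ext arg_cong[of _ _ f] hbm_cong) simp
  interpret prob_space ?M
    unfolding batches_def by (intro prob_space_PiM prob_space_measure_pmf)
  have comp: "(\<lambda>S. S i) \<in> ?M \<rightarrow>\<^sub>M count_space UNIV" for i
  proof -
    have "(\<lambda>S. S i) \<in> ?M \<rightarrow>\<^sub>M measure_pmf ?q"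
      unfolding batches_def by (rule measurable_component_singleton) simp
    then show ?thesis by (simp cong: measurable_cong_sets)
  qed
  have pre: "(\<lambda>S. map S is) \<in> ?M \<rightarrow>\<^sub>M count_space UNIV" for "is" :: "nat list"
  proof (induction "is")
    case (Cons i "is")
    have "(\<lambda>S. (S i, map S is)) \<in> ?M \<rightarrow>\<^sub>M count_space UNIV \<Otimes>\<^sub>M count_space UNIV"
      using comp[of i] Cons by (rule measurable_Pair)
    then have "(\<lambda>S. (S i, map S is)) \<in> ?M \<rightarrow>\<^sub>M count_space UNIV"
      by (simp add: pair_measure_countable)
    from measurable_compose[OF this, of "\<lambda>(x, xs). x # xs" "count_space UNIV"] show ?case
      by simp
  qed simp
  have meas: "(\<lambda>S. g (?pre S)) \<in> borel_measurable ?M"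
    by (rule measurable_compose[OF pre]) simp
  have "AE S in ?M. S i \<in> set_pmf ?q" for i
    unfolding batches_def
    by (rule AE_PiM_component) (auto intro: prob_space_measure_pmf AE_pmfI)
  then have "AE S in ?M. \<forall>i. S i \<in> set_pmf ?q"
    by (simp add: AE_all_countable)
  moreover define X where "X = {xs. set xs \<subseteq> set_pmf ?q \<and> length xs = k}"
  have "finite (set_pmf ?q)"
    using finite_lists_length_eq[OF fin, of B]
    by (auto simp: set_replicate_pmf lists_eq_set elim: rev_finite_subset)
  then have "finite X"
    unfolding X_def by (rule finite_lists_length_eq)
  ultimately have "AE S in ?M. norm (g (?pre S)) \<le> Max ((\<lambda>xs. norm (g xs)) ` X)"
    by (auto elim!: eventually_mono intro!: Max_ge imageI simp: X_def)
  then show ?thesis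
    unfolding eq by (intro integrable_const_bound[OF _ meas])
qed

end

theory Submission
  imports Defs "Jordan_Normal_Form.Spectral_Radius"
begin

unbundle no inner_syntax

text \<open>
  In an orthonormal eigenbasis of \<open>A\<^sup>T A\<close> the noiseless iteration decouples into scalar recurrences
  with \<open>\<beta> = r\<^sup>2\<close>, and \<open>\<alpha>\<close>, \<open>\<beta>\<close> are chosen such that all of them have complex conjugate (or double)
  characteristic roots of modulus \<open>r\<close>; the response to an impulse after \<open>m\<close> steps is then at most
  \<open>(m + 1) r\<^sup>m\<close>. Since \<open>A x\<^sup>* = b\<close>, the gradient noise has conditional mean zero and conditional
  second moment at most \<open>\<eta> \<parallel>A\<parallel>\<^sub>F\<^sup>2 \<lambda>\<^sub>m\<^sub>a\<^sub>x \<parallel>x - x\<^sup>*\<parallel>\<^sup>2 / B\<close>. Mean squares of independent perturbations add up,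
  which gives a recurrence for \<open>E \<parallel>x\<^sub>k - x\<^sup>*\<parallel>\<^sup>2\<close> with kernel \<open>(m + 1)\<^sup>2 r\<^bsup>2m\<^esup>\<close>. With \<open>r = 1 - (1 + c / 2) / \<surd>\<kappa>\<close> and
  \<open>\<rho> = 1 - c / \<surd>\<kappa>\<close> this kernel, discounted by \<open>\<rho>\<^bsup>2m\<^esup>\<close>, has total mass of order \<open>\<kappa>\<^bsup>3/2\<^esup>\<close>, and the lower bound
  on \<open>B\<close> makes the feedback smaller than one.
\<close>

subsection \<open>Spectral theorem for real symmetric matrices\<close>

text \<open>Over the complex numbers an eigenvalue exists, and symmetry of a real matrix makes it
  real. The complex eigenvector need not be real, so a real one is recovered from the root of the
  characteristic polynomial.\<close>

lemma real_symmetric_eigenvector: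
  fixes H :: "real mat"
  assumes H: "H \<in> carrier_mat n n" and sym: "transpose_mat H = H" and n: "n > 0"
  obtains e v where "eigenvector H v e"
proof -
  define C where "C = map_mat complex_of_real H"
  have C: "C \<in> carrier_mat n n" using H by (simp add: C_def)
  have symC: "transpose_mat C = C"
    using sym by (simp add: C_def map_mat_transpose)
  obtain z where "z \<in> spectrum C" using spectrum_non_empty[OF C n] by auto
  then have ev: "eigenvalue C z" by (simp add: spectrum_def)
  then obtain v where v: "v \<in> carrier_vec n" "v \<noteq> 0\<^sub>v n" "C *\<^sub>v v = z \<cdot>\<^sub>v v"
    using C by (auto simp: eigenvalue_def eigenvector_def)
  have "C *\<^sub>v conjugate v = conjugate (C *\<^sub>v v)"
    using H v(1) by (intro eq_vecI)
      (auto simp: C_def scalar_prod_def sum_conjugate conjugate_dist_mul intro!: sum.cong)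
  then have conj: "C *\<^sub>v conjugate v = cnj z \<cdot>\<^sub>v conjugate v"
    using v by (simp add: conjugate_smult_vec)
  have cv: "conjugate v \<in> carrier_vec n" using v by simp
  \<comment> \<open>The Hermitian form of \<open>C\<close> at \<open>v\<close> is evaluated with
    \<open>C\<close> on either side, which gives \<open>z\<close> and \<open>cnj z\<close> times the
    same nonzero number.\<close>
  have "z * (v \<bullet> conjugate v) = (C *\<^sub>v v) \<bullet> conjugate v" using v cv by simp
  also have "\<dots> = v \<bullet> (C *\<^sub>v conjugate v)"
    using transpose_vec_mult_scalar[OF C cv v(1)] symC
      comm_scalar_prod[OF mult_mat_vec_carrier[OF C v(1)] cv]
      comm_scalar_prod[OF v(1) mult_mat_vec_carrier[OF C cv]]
      transpose_vec_mult_scalar[OF C v(1) cv] by simp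
  also have "\<dots> = cnj z * (v \<bullet> conjugate v)" using v cv by (simp add: conj)
  finally have "z = cnj z"
    using v by (simp add: conjugate_square_eq_0_vec)
  then obtain r where r: "z = complex_of_real r"
    by (metis Reals_cases Reals_cnj_iff)
  have "poly (char_poly C) z = 0" using ev C by (simp add: eigenvalue_root_char_poly)
  then have "poly (char_poly H) r = 0"
    using of_real_hom.char_poly_hom[OF H, where 'a = complex] by (simp add: C_def r)
  then show ?thesis
    using that H by (auto simp flip: eigenvalue_root_char_poly simp: eigenvalue_def)
qed

lemma scalar_prod_self_pos:
  fixes v :: "real Matrix.vec"
  assumes v: "v \<in> carrier_vec n" and nz: "v \<noteq> 0\<^sub>v n"
  shows "v \<bullet> v > 0"
proof -
  obtain i where i: "i < n" "vec_index v i \<noteq> 0" using v nz by (metis eq_vecI carrier_vecD index_zero_vec)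
  then have "(\<Sum>i<n. vec_index v i * vec_index v i) > 0"
    by (intro sum_pos2[where i = i]) (auto simp: zero_less_mult_iff)
  then show ?thesis using v by (simp add: scalar_prod_def lessThan_atLeast0)
qed

text \<open>The witness is the Householder reflection exchanging \<open>v\<close> and the first unit vector.\<close>
lemma orthogonal_mat_first_col:
  fixes v :: "real Matrix.vec"
  assumes v: "v \<in> carrier_vec n" and vv: "v \<bullet> v = 1" and n: "n > 0"
  obtains W where "W \<in> carrier_mat n n" "transpose_mat W * W = 1\<^sub>m n" "col W 0 = v"
proof (cases "v = unit_vec n 0")
  case True
  \<comment> \<open>Here the difference \<open>w\<close> used below would vanish and define no
    reflection.\<close>
  then show ?thesis using n by (intro that[of "1\<^sub>m n"]) auto
next
  case False
  define w where "w = v - unit_vec n 0"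
  have w: "w \<in> carrier_vec n" using v by (simp add: w_def)
  define c where "c = 2 / (w \<bullet> w)"
  have "w \<noteq> 0\<^sub>v n" 
  proof
    assume "w = 0\<^sub>v n"
    then have "vec_index w i = 0" if "i < n" for i using that by simp
    then have "v = unit_vec n 0" using v by (intro eq_vecI) (auto simp: w_def)
    then show False using False by simp
  qed
  then have ww0: "w \<bullet> w \<noteq> 0" using scalar_prod_self_pos[OF w] by simp
  have cww: "c * (w \<bullet> w) = 2" using ww0 by (simp add: c_def)
  have ww: "w \<bullet> w = 2 - 2 * vec_index v 0"
    using v n vv unfolding w_def
    by (simp add: minus_scalar_prod_distrib[of _ n] scalar_prod_minus_distrib[of _ n])
  define W where "W = Matrix.mat n n (\<lambda>(i, j). (if i = j then 1 else 0) - c * vec_index w i * vec_index w j)"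
  have "transpose_mat W * W = 1\<^sub>m n"
  proof (rule eq_matI)
    fix i j assume "i < dim_row (1\<^sub>m n :: real mat)" "j < dim_col (1\<^sub>m n :: real mat)"
    then have ij: "i < n" "j < n" by auto
    have "(transpose_mat W * W) $$ (i, j) = (\<Sum>k<n. ((if i = k then 1 else 0) - c * vec_index w i * vec_index w k) *
        ((if k = j then 1 else 0) - c * vec_index w k * vec_index w j))"
      using ij by (auto simp: W_def scalar_prod_def lessThan_atLeast0 mult_ac intro!: sum.cong)
    also have "\<dots> = (\<Sum>k<n. (if i = k then (if k = j then 1 else 0) - c * vec_index w k * vec_index w j else 0)
        - (if k = j then c * vec_index w i * vec_index w k else 0)
        + c * vec_index w i * vec_index w j * (c * (vec_index w k * vec_index w k)))"
      by (intro sum.cong) (auto simp: algebra_simps)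
    also have "\<dots> = (if i = j then 1 else 0) - 2 * c * vec_index w i * vec_index w j
        + c * vec_index w i * vec_index w j * (c * (w \<bullet> w))"
      using ij w by (simp add: sum.distrib sum_subtractf scalar_prod_def lessThan_atLeast0 flip: sum_distrib_left)
    finally show "(transpose_mat W * W) $$ (i, j) = 1\<^sub>m n $$ (i, j)"
      using ij by (simp add: cww)
  qed (auto simp: W_def)
  moreover have "col W 0 = v"
  proof (rule eq_vecI)
    fix i assume "i < dim_vec v"
    then have i: "i < n" using v by simp
    \<comment> \<open>As \<open>v\<close> is a unit vector, the first entry of \<open>w\<close> is
      minus half of \<open>w \<bullet> w\<close>. So the reflection sends the first unit vector to
      itself plus \<open>w\<close>, that is to \<open>v\<close>.\<close>
    have "c * vec_index w 0 = -1" using ww ww0 v n by (simp add: c_def w_def field_simps)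
    then have "c * vec_index w i * vec_index w 0 = - vec_index w i"
      by (metis mult.assoc mult.commute mult_minus1)
    then show "vec_index (col W 0) i = vec_index v i"
      using i n v by (auto simp: W_def w_def)
  qed (use v in \<open>simp add: W_def\<close>)
  ultimately show ?thesis by (intro that[of W]) (auto simp: W_def)
qed

text \<open>Deflation: in an orthonormal basis starting with an eigenvector the first column is a
  multiple of the first unit vector, symmetry gives the same for the first row, and the remaining
  block is symmetric of size one less.\<close>

lemma real_symmetric_diagonalizable:
  fixes H :: "real mat"
  assumes "H \<in> carrier_mat n n" "transpose_mat H = H"
  shows "\<exists>U lam. U \<in> carrier_mat n n \<and> transpose_mat U * U = 1\<^sub>m n \<and>
    transpose_mat U * H * U = mat_diag n lam"
  using assms
proof (induction n arbitrary: H)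
  case 0
  then show ?case by (intro exI[of _ "1\<^sub>m 0"] exI[of _ undefined]) (auto intro!: eq_matI simp: mat_diag_def)
next
  case (Suc m)
  let ?n = "Suc m"
  note H = Suc.prems(1) and sym = Suc.prems(2)
  obtain e v0 where v0: "v0 \<in> carrier_vec ?n" "v0 \<noteq> 0\<^sub>v ?n" "H *\<^sub>v v0 = e \<cdot>\<^sub>v v0"
    using real_symmetric_eigenvector[OF H sym] H unfolding eigenvector_def by (metis carrier_matD(1) zero_less_Suc)
  define v where "v = (1 / sqrt (v0 \<bullet> v0)) \<cdot>\<^sub>v v0"
  have "v0 \<bullet> v0 > 0" using scalar_prod_self_pos v0 by blast
  then have vv: "v \<bullet> v = 1" using v0 by (simp add: v_def field_simps)
  have v: "v \<in> carrier_vec ?n" using v0 by (simp add: v_def)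
  have Hv: "H *\<^sub>v v = e \<cdot>\<^sub>v v"
    using v0 H by (simp add: v_def mult_mat_vec smult_smult_assoc mult.commute)
  obtain W where W: "W \<in> carrier_mat ?n ?n" "transpose_mat W * W = 1\<^sub>m ?n" "col W 0 = v"
    using orthogonal_mat_first_col[OF v vv] by auto
  define M where "M = transpose_mat W * H * W"
  have M: "M \<in> carrier_mat ?n ?n" using W H by (simp add: M_def)
  have symM: "transpose_mat M = M"
  proof -
    have "transpose_mat M = transpose_mat W * transpose_mat (transpose_mat W * H)"
      unfolding M_def using W H by (subst transpose_mult) auto
    also have "transpose_mat (transpose_mat W * H) = transpose_mat H * W"
      using W H by (subst transpose_mult) auto
    finally show ?thesis using W H by (simp add: M_def sym assoc_mult_mat[of _ ?n ?n _ ?n _ ?n])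
  qed
  have "col M 0 = transpose_mat W *\<^sub>v (H *\<^sub>v col W 0)"
    using W H col_mult2[of "transpose_mat W" ?n ?n "H * W" ?n 0] col_mult2[of H ?n ?n W ?n 0]
    by (simp add: M_def assoc_mult_mat[of _ ?n ?n _ ?n _ ?n])
  also have "\<dots> = e \<cdot>\<^sub>v col (transpose_mat W * W) 0"
    using W v Hv col_mult2[of "transpose_mat W" ?n ?n W ?n 0] by (simp add: mult_mat_vec[of _ ?n ?n])
  finally have col0: "col M 0 = e \<cdot>\<^sub>v unit_vec ?n 0" by (simp add: W(2))
  define M3 where "M3 = Matrix.mat m m (\<lambda>(i, j). M $$ (Suc i, Suc j))"
  have M3: "M3 \<in> carrier_mat m m" by (simp add: M3_def)
  have M_i0: "M $$ (i, 0) = (if i = 0 then e else 0)" if "i < ?n" for i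
  proof -
    have "M $$ (i, 0) = vec_index (col M 0) i" using that M by simp
    then show ?thesis using that by (simp add: col0)
  qed
  have M_sym: "M $$ (i, j) = M $$ (j, i)" if "i < ?n" "j < ?n" for i j
    using that M symM by (metis carrier_matD index_transpose_mat(1))
  have M_0i: "M $$ (0, i) = (if i = 0 then e else 0)" if "i < ?n" for i
    using M_sym[of 0 i] M_i0 that by simp
  have Mb: "M = four_block_mat (e \<cdot>\<^sub>m 1\<^sub>m 1) (0\<^sub>m 1 m) (0\<^sub>m m 1) M3"
    using M by (intro eq_matI) (auto simp: M3_def M_i0 M_0i)
  have "transpose_mat M3 = M3" by (intro eq_matI) (auto simp: M3_def M_sym)
  then obtain U3 lam where U3: "U3 \<in> carrier_mat m m" "transpose_mat U3 * U3 = 1\<^sub>m m"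
    "transpose_mat U3 * M3 * U3 = mat_diag m lam"
    using Suc.IH[OF M3] by blast
  define Q where "Q = four_block_mat (1\<^sub>m 1) (0\<^sub>m 1 m) (0\<^sub>m m 1) U3"
  have Q: "Q \<in> carrier_mat ?n ?n" using U3 by (auto simp: Q_def)
  have QT: "transpose_mat Q = four_block_mat (1\<^sub>m 1) (0\<^sub>m 1 m) (0\<^sub>m m 1) (transpose_mat U3)"
    using U3 unfolding Q_def by (subst transpose_four_block_mat) auto
  have QQ: "transpose_mat Q * Q = 1\<^sub>m ?n"
    unfolding QT unfolding Q_def using U3
    by (subst mult_four_block_mat[of _ 1 1 _ m _ m _ _ 1 _ m]) auto
  have QM: "transpose_mat Q * M = four_block_mat (e \<cdot>\<^sub>m 1\<^sub>m 1) (0\<^sub>m 1 m) (0\<^sub>m m 1) (transpose_mat U3 * M3)"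
    unfolding QT Mb using U3 M3 
    by (subst mult_four_block_mat[of _ 1 1 _ m _ m _ _ 1 _ m]) auto
  have QMQ: "transpose_mat Q * M * Q = four_block_mat (e \<cdot>\<^sub>m 1\<^sub>m 1) (0\<^sub>m 1 m) (0\<^sub>m m 1) (mat_diag m lam)"
    unfolding QM unfolding Q_def using U3 M3
    by (subst mult_four_block_mat[of _ 1 1 _ m _ m _ _ 1 _ m]) auto
  have diag: "four_block_mat (e \<cdot>\<^sub>m 1\<^sub>m 1) (0\<^sub>m 1 m) (0\<^sub>m m 1) (mat_diag m lam) = mat_diag ?n (case_nat e lam)"
    by (intro eq_matI) (auto simp: mat_diag_def split: nat.splits)
  define U where "U = W * Q"
  have UT: "transpose_mat U = transpose_mat Q * transpose_mat W"
    using W Q by (simp add: U_def transpose_mult[of _ ?n ?n _ ?n])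
  have "transpose_mat U * U = transpose_mat Q * (transpose_mat W * W) * Q"
    using W(1) Q unfolding UT unfolding U_def by (simp add: assoc_mult_mat[of _ ?n ?n _ ?n _ ?n])
  then have "transpose_mat U * U = 1\<^sub>m ?n" using W Q QQ by simp
  moreover have "transpose_mat U * H * U = transpose_mat Q * M * Q"
    using W(1) Q H unfolding UT unfolding U_def M_def by (simp add: assoc_mult_mat[of _ ?n ?n _ ?n _ ?n])
  ultimately show ?case
    using W Q QMQ diag by (intro exI[of _ U] exI[of _ "case_nat e lam"]) (auto simp: U_def)
qed

text \<open>The columns of the diagonalizing matrix, packaged for coordinatewise work. The last
  clause counts roots with multiplicity, so that the extremes and the average of
  \<open>gram_eigenvalues\<close> can be read off \<open>lam\<close>.\<close>

lemma real_symmetric_eigenbasis: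
  fixes H :: "real mat"
  assumes H: "H \<in> carrier_mat n n" and sym: "transpose_mat H = H"
  obtains u lam where
    "\<And>i. i < n \<Longrightarrow> u i \<in> carrier_vec n"
    "\<And>i. i < n \<Longrightarrow> u i \<bullet> u i = 1"
    "\<And>i. i < n \<Longrightarrow> H *\<^sub>v u i = lam i \<cdot>\<^sub>v u i"
    "\<And>v w. v \<in> carrier_vec n \<Longrightarrow> w \<in> carrier_vec n \<Longrightarrow> v \<bullet> w = (\<Sum>i<n. (u i \<bullet> v) * (u i \<bullet> w))"
    "proots (char_poly H) = image_mset lam (mset_set {..<n})"
proof -
  obtain U lam where U: "U \<in> carrier_mat n n" and UU: "transpose_mat U * U = 1\<^sub>m n"
    and D: "transpose_mat U * H * U = mat_diag n lam"
    using real_symmetric_diagonalizable[OF assms] by blast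
  have UU': "U * transpose_mat U = 1\<^sub>m n"
    using mat_mult_left_right_inverse[OF _ U UU] U by simp
  have HU: "H * U = U * mat_diag n lam"
  proof -
    have "U * mat_diag n lam = (U * transpose_mat U) * (H * U)"
      unfolding D[symmetric] using U H by (simp add: assoc_mult_mat[of _ n n _ n _ n])
    then show ?thesis using UU' U H by simp
  qed
  show ?thesis
  proof (rule that[of "col U" lam])
    show "col U i \<in> carrier_vec n" if "i < n" for i using U that by auto
    show "col U i \<bullet> col U i = 1" if "i < n" for i
    proof -
      have "(transpose_mat U * U) $$ (i, i) = 1" using UU that by simp
      then show ?thesis using U that by simp
    qed
    show "H *\<^sub>v col U i = lam i \<cdot>\<^sub>v col U i" if i: "i < n" for i
    proof -
      have "H *\<^sub>v col U i = col (U * mat_diag n lam) i" using col_mult2[OF H U i] HU by simp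
      also have "\<dots> = lam i \<cdot>\<^sub>v col U i"
        using U i by (intro eq_vecI) (auto simp: mat_diag_mult_right[OF U])
      finally show ?thesis .
    qed
    show "v \<bullet> w = (\<Sum>i<n. (col U i \<bullet> v) * (col U i \<bullet> w))"
      if v: "v \<in> carrier_vec n" and w: "w \<in> carrier_vec n" for v w
    proof -
      have "v \<bullet> w = (U * transpose_mat U *\<^sub>v v) \<bullet> w" using v by (simp add: UU')
      also have "\<dots> = (U *\<^sub>v (transpose_mat U *\<^sub>v v)) \<bullet> w"
        using U v by (subst assoc_mult_mat_vec[of _ n n _ n]) auto
      also have "\<dots> = (transpose_mat U *\<^sub>v v) \<bullet> (transpose_mat U *\<^sub>v w)"
        using transpose_vec_mult_scalar[of "transpose_mat U" n n w "transpose_mat U *\<^sub>v v"] U v w by auto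
      also have "\<dots> = (\<Sum>i<n. (col U i \<bullet> v) * (col U i \<bullet> w))"
        using U by (auto simp: scalar_prod_def[of "transpose_mat U *\<^sub>v v"] lessThan_atLeast0 intro!: sum.cong)
      finally show ?thesis .
    qed
    \<comment> \<open>Similarity preserves the characteristic polynomial, which for a diagonal
      matrix splits into the linear factors of the diagonal entries.\<close>
    have "similar_mat H (mat_diag n lam)"
    proof (rule similar_matI[of _ _ U "transpose_mat U" n])
      show "H = U * mat_diag n lam * transpose_mat U"
        unfolding HU[symmetric] using U H UU' by (simp add: assoc_mult_mat[of _ n n _ n _ n])
    qed (use U H UU UU' in auto)
    then have "char_poly H = (\<Prod>a\<leftarrow>diag_mat (mat_diag n lam). [:- a, 1:])"
      by (subst char_poly_similar, assumption)
        (rule char_poly_upper_triangular[of _ n], auto simp: mat_diag_def upper_triangular_def)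
    moreover have "diag_mat (mat_diag n lam) = map lam [0..<n]"
      by (auto simp: diag_mat_def mat_diag_def)
    ultimately have cp: "char_poly H = (\<Prod>a\<leftarrow>map lam [0..<n]. [:- a, 1:])" by simp
    have "proots (\<Prod>a\<leftarrow>xs. [:- a, 1:]) = mset xs" for xs :: "real list"
    proof (induction xs)
      case (Cons a xs)
      have "proots ([:- a, 1:] * (\<Prod>a\<leftarrow>xs. [:- a, 1:])) = proots [:- a, 1:] + proots (\<Prod>a\<leftarrow>xs. [:- a, 1:])"
        by (rule proots_mult) (auto simp: prod_list_zero_iff)
      then show ?case using Cons by (simp del: mult_pCons_left)
    qed simp
    from this[of "map lam [0..<n]"] show "proots (char_poly H) = image_mset lam (mset_set {..<n})"
      by (simp add: cp lessThan_atLeast0)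
  qed
qed

subsection \<open>The scalar heavy ball recurrence\<close>

text \<open>
  \<open>heavy_ball_seq (1 + \<beta> - \<alpha> \<lambda>) \<beta> (m + 1)\<close> is the response, \<open>m\<close> steps later, to a unit impulse in an
  eigendirection with eigenvalue \<open>\<lambda>\<close>.
\<close>
fun heavy_ball_seq :: "real \<Rightarrow> real \<Rightarrow> nat \<Rightarrow> real" where
  "heavy_ball_seq t \<beta> 0 = 0"
| "heavy_ball_seq t \<beta> (Suc 0) = 1"
| "heavy_ball_seq t \<beta> (Suc (Suc m)) = t * heavy_ball_seq t \<beta> (Suc m) - \<beta> * heavy_ball_seq t \<beta> m"

text \<open>
  The characteristic roots \<open>z\<close> and \<open>cnj z\<close> have modulus \<open>r\<close>, and dividing out one of them leaves
  the powers of the other.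
\<close>
lemma abs_heavy_ball_seq_Suc_le:
  fixes t r :: real
  assumes r: "r \<ge> 0" and t: "t\<^sup>2 \<le> 4 * r\<^sup>2"
  shows "\<bar>heavy_ball_seq t (r\<^sup>2) (Suc m)\<bar> \<le> real (Suc m) * r ^ m"
proof -
  let ?g = "heavy_ball_seq t (r\<^sup>2)"
  \<comment> \<open>The hypothesis on \<open>t\<close> makes the radicand nonnegative, so that the
    modulus of \<open>z\<close> is exactly \<open>r\<close>.\<close>
  define z where "z = Complex (t / 2) (sqrt (r\<^sup>2 - t\<^sup>2 / 4))"
  have z: "z + cnj z = complex_of_real t" by (simp add: z_def complex_eq_iff)
  have zz: "z * cnj z = complex_of_real (r\<^sup>2)"
    using t by (simp add: z_def complex_eq_iff power2_eq_square)
  have norm_z: "cmod z = r"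
    using t r by (simp add: z_def cmod_def power_divide)
  have *: "complex_of_real (?g (Suc m)) = z * ?g m + cnj z ^ m" for m
  proof (induction m)
    case (Suc m)
    have "complex_of_real (?g (Suc (Suc m))) = (z + cnj z) * ?g (Suc m) - z * cnj z * ?g m"
      unfolding z zz by simp
    also have "\<dots> = z * ?g (Suc m) + cnj z * (?g (Suc m) - z * ?g m)"
      by (simp add: algebra_simps)
    also have "?g (Suc m) - z * ?g m = cnj z ^ m" using Suc by simp
    finally show ?case by simp
  qed simp
  show ?thesis
  proof (induction m)
    case (Suc m)
    have "\<bar>?g (Suc (Suc m))\<bar> = cmod (z * ?g (Suc m) + cnj z ^ Suc m)"
      using *[of "Suc m"] by (metis norm_of_real)
    also have "\<dots> \<le> r * \<bar>?g (Suc m)\<bar> + r ^ Suc m"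
      by (rule order.trans[OF norm_triangle_ineq]) (simp add: norm_mult norm_power norm_z)
    also have "\<dots> \<le> r * (real (Suc m) * r ^ m) + r ^ Suc m"
      using Suc r by (intro add_right_mono mult_left_mono)
    finally show ?case by (simp add: algebra_simps)
  qed simp
qed

text \<open>Both iterates start at the same point, so an initial coordinate gets multiplied by this
  difference. Each of its terms is at most \<open>(m + 1) r^m\<close> in modulus, whence the 4 after
  squaring.\<close>

lemma heavy_ball_seq_initial_bound:
  fixes t r :: real
  assumes r: "0 \<le> r" "r \<le> 1" and t: "t\<^sup>2 \<le> 4 * r\<^sup>2"
  shows "(heavy_ball_seq t (r\<^sup>2) (Suc m) - r\<^sup>2 * heavy_ball_seq t (r\<^sup>2) m)\<^sup>2 \<le> 4 * (real (Suc m))\<^sup>2 * (r\<^sup>2) ^ m"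
proof -
  let ?g = "heavy_ball_seq t (r\<^sup>2)"
  have "r\<^sup>2 * \<bar>?g m\<bar> \<le> real (Suc m) * r ^ m"
  \<comment> \<open>The bound on the sequence is available at successors; at 0 the sequence
    vanishes.\<close>
  proof (cases m)
    case (Suc k)
    have "r\<^sup>2 * \<bar>?g m\<bar> \<le> r\<^sup>2 * (real m * r ^ k)"
      unfolding Suc by (intro mult_left_mono abs_heavy_ball_seq_Suc_le r t) simp
    also have "\<dots> = r * (real m * r ^ m)" by (simp add: Suc power2_eq_square)
    also have "\<dots> \<le> 1 * (real (Suc m) * r ^ m)"
      using r by (intro mult_mono mult_right_mono) auto
    finally show ?thesis by simp
  qed simp
  then have "\<bar>?g (Suc m) - r\<^sup>2 * ?g m\<bar> \<le> 2 * (real (Suc m) * r ^ m)"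
    using abs_heavy_ball_seq_Suc_le[OF r(1) t, of m] abs_triangle_ineq4[of "?g (Suc m)" "r\<^sup>2 * ?g m"]
    by (simp add: abs_mult)
  then have "\<bar>?g (Suc m) - r\<^sup>2 * ?g m\<bar>\<^sup>2 \<le> (2 * (real (Suc m) * r ^ m))\<^sup>2"
    by (intro power_mono) auto
  then show ?thesis by (simp add: power_mult_distrib power_mult[symmetric] mult.commute mult.assoc)
qed

text \<open>The weights \<open>(i + 1)^2\<close> are dominated by \<open>(i + 1) (i + 2)\<close>,
  the power series coefficients of \<open>2 / (1 - q)^3\<close>.\<close>

lemma sum_square_geometric_le:
  fixes q :: real
  assumes q: "0 \<le> q" "q < 1"
  shows "(\<Sum>i<m. (real (Suc i))\<^sup>2 * q ^ i) \<le> 2 / (1 - q) ^ 3"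
proof -
  \<comment> \<open>The exact partial sum; the subtracted remainder is nonnegative for
    \<open>q\<close> in the unit interval.\<close>
  have eq: "(1 - q) ^ 3 * (\<Sum>i<m. (real i + 1) * (real i + 2) * q ^ i) =
    2 - q ^ m * ((real m + 1) * (real m + 2) * (1 - q)\<^sup>2 + 2 * (real m + 2) * q * (1 - q) + 2 * q\<^sup>2)"
    by (induction m) (auto simp: algebra_simps power2_eq_square power3_eq_cube)
  have "(\<Sum>i<m. (real (Suc i))\<^sup>2 * q ^ i) \<le> (\<Sum>i<m. (real i + 1) * (real i + 2) * q ^ i)"
    using q by (intro sum_mono mult_right_mono) (auto simp: power2_eq_square algebra_simps)
  then have "(1 - q) ^ 3 * (\<Sum>i<m. (real (Suc i))\<^sup>2 * q ^ i) \<le>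
      (1 - q) ^ 3 * (\<Sum>i<m. (real i + 1) * (real i + 2) * q ^ i)"
    using q by (intro mult_left_mono) auto
  also have "\<dots> \<le> 2" unfolding eq using q by simp
  finally show ?thesis using q by (simp add: field_simps)
qed

text \<open>
  The bound \<open>\<psi>\<close> satisfies \<open>\<psi> (m + 1) + \<tau> (m + 1)\<^sup>2 r\<^bsup>2m\<^esup> = \<rho>\<^sup>2 \<psi> m\<close> and \<open>\<psi> 0 = 1\<close>; the noise level
  \<open>\<tau>\<close> is small enough to keep \<open>\<psi> m \<ge> \<rho>\<^bsup>2m\<^esup> / 2\<close>.
\<close>
lemma noisy_recurrence_bound:
  fixes b :: "nat \<Rightarrow> nat \<Rightarrow> real"
  assumes r: "0 \<le> r" "r < \<rho>" and \<tau>: "0 \<le> \<tau>"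
    and small: "\<tau> / \<rho>\<^sup>2 * (2 / (1 - r\<^sup>2 / \<rho>\<^sup>2) ^ 3) \<le> 1 / 2"
    and step: "\<And>m j. b m (Suc j) \<le> b (Suc m) j + \<tau> * (real (Suc m))\<^sup>2 * (r\<^sup>2) ^ m * b 0 j"
    and init: "\<And>m. b m 0 \<le> 4 * (real (Suc m))\<^sup>2 * (r\<^sup>2) ^ m * E" and E: "0 \<le> E"
  shows "b 0 j \<le> 16 / (1 - r\<^sup>2 / \<rho>\<^sup>2) ^ 3 * E * (\<rho>\<^sup>2) ^ j"
proof -
  define q where "q = r\<^sup>2 / \<rho>\<^sup>2"
  \<comment> \<open>16 is the 4 of the initial bound, times the 2 of the kernel mass, times the 2
    that compensates for \<open>y m\<close> being as small as one half.\<close>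
  define N where "N = 16 / (1 - q) ^ 3"
  have \<rho>: "\<rho> > 0" using r by simp
  have q: "0 \<le> q" "q < 1"
    using r \<rho> by (auto simp: q_def intro!: power_strict_mono)
  have rq: "(r\<^sup>2) ^ m = q ^ m * (\<rho>\<^sup>2) ^ m" for m using \<rho> by (simp add: q_def power_divide)
  define y where "y m = 1 - \<tau> / \<rho>\<^sup>2 * (\<Sum>i<m. (real (Suc i))\<^sup>2 * q ^ i)" for m
  define \<psi> where "\<psi> m = (\<rho>\<^sup>2) ^ m * y m" for m
  have y: "y m \<ge> 1 / 2" for m
  proof -
    have "\<tau> / \<rho>\<^sup>2 * (\<Sum>i<m. (real (Suc i))\<^sup>2 * q ^ i) \<le> \<tau> / \<rho>\<^sup>2 * (2 / (1 - q) ^ 3)"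
      using \<tau> by (intro mult_left_mono sum_square_geometric_le q) auto
    also have "\<dots> \<le> 1 / 2" using small by (simp add: q_def)
    finally show ?thesis by (simp add: y_def)
  qed
  have \<psi>_step: "\<psi> (Suc m) + \<tau> * (real (Suc m))\<^sup>2 * (r\<^sup>2) ^ m = \<rho>\<^sup>2 * \<psi> m" for m
    using \<rho> by (simp add: \<psi>_def y_def rq field_simps)
  have "b m j \<le> N * E * (\<rho>\<^sup>2) ^ j * \<psi> m" for m
  \<comment> \<open>The horizon \<open>m\<close> is generalized because \<open>step\<close> trades
    one update for a horizon longer by one.\<close>
  proof (induction j arbitrary: m)
    case 0
    have "(real (Suc m))\<^sup>2 * q ^ m \<le> (\<Sum>i<Suc m. (real (Suc i))\<^sup>2 * q ^ i)"
      using q by (simp add: sum_nonneg)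
    also have "\<dots> \<le> 2 / (1 - q) ^ 3" by (rule sum_square_geometric_le[OF q])
    finally have "4 * ((real (Suc m))\<^sup>2 * q ^ m) \<le> N * (1 / 2)" by (simp add: N_def)
    also have "\<dots> \<le> N * y m" using y q by (intro mult_left_mono) (auto simp: N_def)
    finally have "4 * ((real (Suc m))\<^sup>2 * q ^ m) * ((\<rho>\<^sup>2) ^ m * E) \<le> N * y m * ((\<rho>\<^sup>2) ^ m * E)"
      using E by (intro mult_right_mono) auto
    then show ?case using init[of m] by (simp add: rq \<psi>_def mult_ac)
  next
    case (Suc j)
    have "b m (Suc j) \<le> b (Suc m) j + \<tau> * (real (Suc m))\<^sup>2 * (r\<^sup>2) ^ m * b 0 j" by (rule step)
    also have "\<dots> \<le> N * E * (\<rho>\<^sup>2) ^ j * \<psi> (Suc m)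
        + \<tau> * (real (Suc m))\<^sup>2 * (r\<^sup>2) ^ m * (N * E * (\<rho>\<^sup>2) ^ j * \<psi> 0)"
      using \<tau> by (intro add_mono mult_left_mono Suc) auto
    also have "\<dots> = N * E * (\<rho>\<^sup>2) ^ j * (\<psi> (Suc m) + \<tau> * (real (Suc m))\<^sup>2 * (r\<^sup>2) ^ m)"
      by (simp add: \<psi>_def y_def algebra_simps)
    finally show ?case unfolding \<psi>_step by (simp add: mult_ac)
  qed
  from this[of 0] show ?thesis by (simp add: \<psi>_def y_def N_def q_def)
qed

subsection \<open>Expectations over independent batches\<close>

text \<open>The iterated transition operator of the chain with random update \<open>T\<close>,
  unrolled from the first draw. It replaces conditional expectations on the sequence space by nested
  finite ones.\<close>

primrec mean_after :: "'s pmf \<Rightarrow> ('s \<Rightarrow> 'z \<Rightarrow> 'z) \<Rightarrow> nat \<Rightarrow> ('z \<Rightarrow> real) \<Rightarrow> 'z \<Rightarrow> real" where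
  "mean_after q T 0 f z = f z"
| "mean_after q T (Suc k) f z = measure_pmf.expectation q (\<lambda>s. mean_after q T k f (T s z))"

text \<open>The one-step inequality is applied to the last of the \<open>k + 1\<close> draws and
  then averaged over the first \<open>k\<close>. The invariant set \<open>I\<close> allows it to be
  assumed only for states of the right dimension.\<close>

lemma mean_after_Suc_le:
  assumes fin: "finite (set_pmf q)"
    and inv: "\<And>s z. s \<in> set_pmf q \<Longrightarrow> z \<in> I \<Longrightarrow> T s z \<in> I"
    and step: "\<And>z. z \<in> I \<Longrightarrow> measure_pmf.expectation q (\<lambda>s. f (T s z)) \<le> g z + c * h z"
    and z: "z \<in> I"
  shows "mean_after q T (Suc k) f z \<le> mean_after q T k g z + c * mean_after q T k h z"
  using z
proof (induction k arbitrary: z)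
  case 0
  then show ?case using step by simp
next
  case (Suc k)
  note int = integrable_measure_pmf_finite[OF fin]
  have "mean_after q T (Suc (Suc k)) f z
      \<le> measure_pmf.expectation q (\<lambda>s. mean_after q T k g (T s z) + c * mean_after q T k h (T s z))"
    unfolding mean_after.simps(2)[of q T "Suc k"]
    using Suc inv by (intro integral_mono_AE int AE_pmfI) auto
  also have "\<dots> = mean_after q T (Suc k) g z + c * mean_after q T (Suc k) h z"
    by (simp add: int)
  finally show ?case .
qed

text \<open>The state type carries no sigma-algebra. Measurability comes from the countability of
  the draws: the last one is split by its value and absorbed into \<open>f\<close>.\<close>

lemma countable_fold_measurable:
  fixes T :: "'s::countable \<Rightarrow> 'z \<Rightarrow> 'z" and f :: "'z \<Rightarrow> real"
  shows "(\<lambda>S. f (fold T (map S [0..<k]) z)) \<in> borel_measurable (PiM UNIV (\<lambda>_. measure_pmf q))"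
proof (induction k arbitrary: f)
  case (Suc k)
  have [measurable]: "(\<lambda>S. S k) \<in> PiM UNIV (\<lambda>_. measure_pmf q) \<rightarrow>\<^sub>M count_space UNIV"
    using measurable_component_singleton[of k UNIV "\<lambda>_. measure_pmf q"] by (simp cong: measurable_cong_sets)
  have "(\<lambda>S. f (T (S k) (fold T (map S [0..<k]) z))) \<in> borel_measurable (PiM UNIV (\<lambda>_. measure_pmf q))"
    by (rule measurable_compose_countable[where f = "\<lambda>s S. f (T s (fold T (map S [0..<k]) z))"]) (use Suc in auto)
  then show ?case by simp
qed simp

text \<open>Detaching the first coordinate of the product and applying Fubini reproduces the
  recursion of \<open>mean_after\<close>.\<close>

lemma integral_iid_fold:
  fixes T :: "'s::countable \<Rightarrow> 'z \<Rightarrow> 'z" and f :: "'z \<Rightarrow> real"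
  assumes fin: "finite (set_pmf q)"
  shows "(\<integral>S. f (fold T (map S [0..<k]) z) \<partial>PiM UNIV (\<lambda>_. measure_pmf q)) = mean_after q T k f z"
proof -
  interpret sequence_space "measure_pmf q" by standard
  interpret PS: pair_prob_space "measure_pmf q" S by standard
  note meas = countable_fold_measurable[of _ T _ _ q]
  have int: "integrable S (\<lambda>S. f (fold T (map S [0..<k]) z))" for k and f :: "'z \<Rightarrow> real" and z
  proof -
    have "AE w in S. w i \<in> set_pmf q" for i
      by (rule AE_PiM_component) (auto intro: prob_space_measure_pmf AE_pmfI)
    then have "AE w in S. \<forall>i. w i \<in> set_pmf q" by (simp add: AE_all_countable)
    \<comment> \<open>Almost surely the first \<open>k\<close> draws form one of finitely many
      lists, so the integrand is essentially bounded.\<close>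
    moreover define X where "X = {xs. set xs \<subseteq> set_pmf q \<and> length xs = k}"
    have "finite X" unfolding X_def using fin by (rule finite_lists_length_eq)
    ultimately have "AE w in S. norm (f (fold T (map w [0..<k]) z)) \<le> Max ((\<lambda>xs. norm (f (fold T xs z))) ` X)"
      by (auto elim!: eventually_mono intro!: Max_ge imageI simp: X_def)
    then show ?thesis by (rule P.integrable_const_bound) (rule meas)
  qed
  show "(\<integral>S. f (fold T (map S [0..<k]) z) \<partial>S) = mean_after q T k f z"
  proof (induction k arbitrary: z)
    case 0
    then show ?case by (simp add: P.prob_space)
  next
    case (Suc k)
    let ?F = "\<lambda>w. f (fold T (map w [0..<Suc k]) z)"
    have [measurable]: "(\<lambda>(s, w). case_nat s w) \<in> measure_pmf q \<Otimes>\<^sub>M S \<rightarrow>\<^sub>M S" by measurable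
    have cons: "?F (case_nat s w) = f (fold T (map w [0..<k]) (T s z))" for s w
      unfolding map_upt_Suc by simp
    have intF: "integrable (measure_pmf q \<Otimes>\<^sub>M S) (\<lambda>x. ?F (case x of (s, w) \<Rightarrow> case_nat s w))"
      using int[of f "Suc k" z] integrable_distr[of "\<lambda>(s, w). case_nat s w" "measure_pmf q \<Otimes>\<^sub>M S" S ?F] 
      by (simp add: PiM_iter)
    have "(\<integral>w. ?F w \<partial>S) = (\<integral>w. ?F w \<partial>distr (measure_pmf q \<Otimes>\<^sub>M S) S (\<lambda>(s, w). case_nat s w))"
      by (simp add: PiM_iter)
    also have "\<dots> = (\<integral>x. ?F (case x of (s, w) \<Rightarrow> case_nat s w) \<partial>(measure_pmf q \<Otimes>\<^sub>M S))"
      by (rule integral_distr[OF _ meas]) measurable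
    also have "\<dots> = (\<integral>s. \<integral>w. ?F (case_nat s w) \<partial>S \<partial>measure_pmf q)"
      using PS.integral_fst'[OF intF] by simp
    also have "\<dots> = mean_after q T (Suc k) f z"
      by (simp only: cons Suc mean_after.simps)
    finally show ?case .
  qed
qed

lemma finite_set_replicate_pmf:
  assumes "finite (set_pmf p)"
  shows "finite (set_pmf (replicate_pmf n p))"
  using finite_lists_length_eq[OF assms, of n]
  by (auto simp: set_replicate_pmf lists_eq_set elim: rev_finite_subset)

lemma expectation_replicate_pmf_Suc:
  fixes h :: "'a list \<Rightarrow> real"
  assumes fin: "finite (set_pmf p)"
  shows "measure_pmf.expectation (replicate_pmf (Suc n) p) h =
    measure_pmf.expectation p (\<lambda>x. measure_pmf.expectation (replicate_pmf n p) (\<lambda>xs. h (x # xs)))"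
proof -
  have fr: "finite (set_pmf (replicate_pmf n p))"
    by (rule finite_set_replicate_pmf[OF fin])
  have "replicate_pmf (Suc n) p = p \<bind> (\<lambda>x. map_pmf ((#) x) (replicate_pmf n p))"
    by (simp add: map_pmf_def)
  then show ?thesis
    using fin fr by (simp add: pmf_expectation_bind[of "set_pmf p"] integral_measure_pmf[of "set_pmf p"])
qed

text \<open>Independent centred terms leave no cross terms. The offset \<open>t\<close> is general
  so that the induction can absorb the first draw into it.\<close>

lemma expectation_replicate_pmf_square:
  fixes Y :: "'a \<Rightarrow> real"
  assumes fin: "finite (set_pmf p)" and mean: "measure_pmf.expectation p Y = 0"
  shows "measure_pmf.expectation (replicate_pmf n p) (\<lambda>xs. (t + sum_list (map Y xs))\<^sup>2) =
    t\<^sup>2 + real n * measure_pmf.expectation p (\<lambda>x. (Y x)\<^sup>2)"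
proof (induction n arbitrary: t)
  case (Suc n)
  note int = integrable_measure_pmf_finite[OF fin]
  have "measure_pmf.expectation (replicate_pmf (Suc n) p) (\<lambda>xs. (t + sum_list (map Y xs))\<^sup>2) =
    measure_pmf.expectation p (\<lambda>x. (t + Y x)\<^sup>2 + real n * measure_pmf.expectation p (\<lambda>x. (Y x)\<^sup>2))"
    unfolding expectation_replicate_pmf_Suc[OF fin] Suc[symmetric] by (simp add: add.assoc)
  also have "\<dots> = measure_pmf.expectation p (\<lambda>x. t\<^sup>2 + 2 * t * Y x + (Y x)\<^sup>2 + real n * measure_pmf.expectation p (\<lambda>x. (Y x)\<^sup>2))"
    by (simp add: power2_sum algebra_simps)
  also have "\<dots> = t\<^sup>2 + real (Suc n) * measure_pmf.expectation p (\<lambda>x. (Y x)\<^sup>2)"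
    by (simp add: int mean algebra_simps)
  finally show ?case .
qed simp

subsection \<open>One step of the method\<close>

text \<open>Pairing the current iterate with the previous one turns the two-term recursion into a
  one-step update.\<close>

definition hbm_step ::
  "real mat \<Rightarrow> real Matrix.vec \<Rightarrow> nat pmf \<Rightarrow> real \<Rightarrow> real \<Rightarrow> nat list \<Rightarrow>
   real Matrix.vec \<times> real Matrix.vec \<Rightarrow> real Matrix.vec \<times> real Matrix.vec" where
  "hbm_step A b p \<alpha> \<beta> s z =
     (fst z - \<alpha> \<cdot>\<^sub>v batch_grad A b p s (fst z) + \<beta> \<cdot>\<^sub>v (fst z - snd z), fst z)"

text \<open>The start \<open>(x0, x0)\<close> holds iterates 1 and 0, so \<open>k\<close> updates
  give iterates \<open>k + 1\<close> and \<open>k\<close>; the first batch consumed has index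
  1.\<close>

lemma hbm_eq_fold:
  "(hbm A b p \<alpha> \<beta> x0 S (Suc k), hbm A b p \<alpha> \<beta> x0 S k) =
    fold (hbm_step A b p \<alpha> \<beta>) (map (\<lambda>i. S (Suc i)) [0..<k]) (x0, x0)"
proof (induction k)
  case (Suc k)
  show ?case by (simp flip: Suc) (simp add: hbm_step_def)
qed simp

text \<open>The batch \<open>S 0\<close> is never used, so the sequence has to be shifted first.\<close>
lemma hbm_expectation:
  fixes f :: "real Matrix.vec \<Rightarrow> real"
  assumes fin: "finite (set_pmf p)"
  shows "(\<integral>S. f (hbm A b p \<alpha> \<beta> x0 S (Suc k)) \<partial>batches B p) =
    mean_after (replicate_pmf B p) (hbm_step A b p \<alpha> \<beta>) k (\<lambda>z. f (fst z)) (x0, x0)"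
proof -
  let ?q = "replicate_pmf B p"
  let ?M = "PiM UNIV (\<lambda>_::nat. measure_pmf ?q)"
  let ?F = "\<lambda>S. f (fst (fold (hbm_step A b p \<alpha> \<beta>) (map S [0..<k]) (x0, x0)))"
  \<comment> \<open>Reindexing along the injective map \<open>Suc\<close> preserves a product of
    identical factors.\<close>
  have shift: "distr ?M ?M (\<lambda>S i. S (Suc i)) = ?M"
    using distr_PiM_reindex[of UNIV "\<lambda>_::nat. measure_pmf ?q" Suc UNIV]
    by (simp add: prob_space_measure_pmf restrict_UNIV)
  have fin': "finite (set_pmf ?q)"
    by (rule finite_set_replicate_pmf[OF fin])
  have "(\<integral>S. f (hbm A b p \<alpha> \<beta> x0 S (Suc k)) \<partial>batches B p) = (\<integral>S. ?F (\<lambda>i. S (Suc i)) \<partial>?M)"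
    unfolding batches_def by (simp flip: hbm_eq_fold)
  also have "\<dots> = (\<integral>S. ?F S \<partial>distr ?M ?M (\<lambda>S i. S (Suc i)))"
  proof (rule integral_distr[symmetric])
    show "(\<lambda>S i. S (Suc i)) \<in> ?M \<rightarrow>\<^sub>M ?M"
      by (rule measurable_PiM_single') (auto simp: space_PiM)
    show "?F \<in> borel_measurable ?M"
      using countable_fold_measurable[of "\<lambda>z. f (fst z)"] .
  qed
  also have "\<dots> = mean_after ?q (hbm_step A b p \<alpha> \<beta>) k (\<lambda>z. f (fst z)) (x0, x0)"
    unfolding shift by (rule integral_iid_fold[OF fin'])
  finally show ?thesis .
qed

lemma batch_grad_carrier [simp]:
  assumes "A \<in> carrier_mat n d"
  shows "batch_grad A b p S x \<in> carrier_vec d"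
proof -
  have "foldr (+) (map (\<lambda>j. (1 / pmf p j * (scalar_prod (Matrix.row A j) x - vec_index b j)) \<cdot>\<^sub>v Matrix.row A j) S)
         (0\<^sub>v (dim_col A)) \<in> carrier_vec d"
    using assms by (induction S) auto
  then show ?thesis by (simp add: batch_grad_def)
qed

lemma scalar_prod_batch_grad:
  assumes A: "A \<in> carrier_mat n d" and v: "v \<in> carrier_vec d"
  shows "v \<bullet> batch_grad A b p S x = 1 / real (length S) *
    sum_list (map (\<lambda>j. 1 / pmf p j * (Matrix.row A j \<bullet> x - vec_index b j) * (v \<bullet> Matrix.row A j)) S)"
proof -
  let ?s = "\<lambda>S. foldr (+) (map (\<lambda>j. (1 / pmf p j * (scalar_prod (Matrix.row A j) x - vec_index b j)) \<cdot>\<^sub>v Matrix.row A j) S)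
         (0\<^sub>v (dim_col A))"
  have row: "Matrix.row A j \<in> carrier_vec d" for j using A by (intro carrier_vecI) auto
  have s: "?s S \<in> carrier_vec d" for S using A row by (induction S) auto
  have "v \<bullet> ?s S = sum_list (map (\<lambda>j. 1 / pmf p j * (Matrix.row A j \<bullet> x - vec_index b j) * (v \<bullet> Matrix.row A j)) S)"
  proof (induction S)
    case (Cons j S)
    then show ?case using v row s[of S] by (simp add: scalar_prod_add_distrib[of _ d])
  qed (use A v in simp)
  then show ?thesis using v s[of S] by (simp add: batch_grad_def)
qed

section \<open>Row sums in an eigenbasis of the Gram matrix\<close>

locale gram_eigenbasis =
  fixes A :: "real mat" and n d :: nat and u :: "nat \<Rightarrow> real Matrix.vec" and lam :: "nat \<Rightarrow> real"
  assumes A: "A \<in> carrier_mat n d"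
    and u: "\<And>i. i < d \<Longrightarrow> u i \<in> carrier_vec d"
    and u_norm: "\<And>i. i < d \<Longrightarrow> u i \<bullet> u i = 1"
    and u_eigen: "\<And>i. i < d \<Longrightarrow> (transpose_mat A * A) *\<^sub>v u i = lam i \<cdot>\<^sub>v u i"
    and parseval: "\<And>v w. v \<in> carrier_vec d \<Longrightarrow> w \<in> carrier_vec d \<Longrightarrow> v \<bullet> w = (\<Sum>i<d. (u i \<bullet> v) * (u i \<bullet> w))"
begin

lemma row_carrier: "Matrix.row A j \<in> carrier_vec d"
  using A by (intro carrier_vecI) auto

lemma sum_rows_scalar_prod:
  assumes v: "v \<in> carrier_vec d" and w: "w \<in> carrier_vec d"
  shows "(\<Sum>j<n. (Matrix.row A j \<bullet> v) * (Matrix.row A j \<bullet> w)) = ((transpose_mat A * A) *\<^sub>v v) \<bullet> w"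
proof -
  have "((transpose_mat A * A) *\<^sub>v v) \<bullet> w = (A *\<^sub>v v) \<bullet> (A *\<^sub>v w)"
    using A v w transpose_vec_mult_scalar[OF A w, of "A *\<^sub>v v"] by simp
  also have "\<dots> = (\<Sum>j<n. (Matrix.row A j \<bullet> v) * (Matrix.row A j \<bullet> w))"
    using A by (auto simp: scalar_prod_def[of "A *\<^sub>v v"] lessThan_atLeast0 intro!: sum.cong)
  finally show ?thesis ..
qed

text \<open>By symmetry the Gram matrix can be placed on the eigenvector. Once the weights
  \<open>pmf p j\<close> cancel, such a sum is the mean of a sampled gradient coordinate.\<close>

lemma sum_rows_eigenvector:
  assumes "i < d" and v: "v \<in> carrier_vec d"
  shows "(\<Sum>j<n. (Matrix.row A j \<bullet> v) * (u i \<bullet> Matrix.row A j)) = lam i * (u i \<bullet> v)"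
proof -
  have "(\<Sum>j<n. (Matrix.row A j \<bullet> v) * (u i \<bullet> Matrix.row A j)) =
      (\<Sum>j<n. (Matrix.row A j \<bullet> u i) * (Matrix.row A j \<bullet> v))"
    using comm_scalar_prod[OF u row_carrier] assms(1) by (simp add: mult.commute)
  also have "\<dots> = lam i * (u i \<bullet> v)"
    using assms by (simp add: sum_rows_scalar_prod u u_eigen)
  finally show ?thesis .
qed

lemma sum_rows_square:
  assumes v: "v \<in> carrier_vec d"
  shows "(\<Sum>j<n. (Matrix.row A j \<bullet> v)\<^sup>2) = (\<Sum>i<d. lam i * (u i \<bullet> v)\<^sup>2)"
proof -
  let ?Hv = "(transpose_mat A * A) *\<^sub>v v"
  have Hv: "?Hv \<in> carrier_vec d" using A v by simp
  have "u i \<bullet> ?Hv = lam i * (u i \<bullet> v)" if "i < d" for i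
  proof -
    have "u i \<bullet> ?Hv = ?Hv \<bullet> u i" using that by (intro comm_scalar_prod[OF u Hv])
    also have "\<dots> = (\<Sum>j<n. (Matrix.row A j \<bullet> v) * (u i \<bullet> Matrix.row A j))"
      using that v comm_scalar_prod[OF u row_carrier] by (simp flip: sum_rows_scalar_prod add: u)
    finally show ?thesis using that v by (simp add: sum_rows_eigenvector)
  qed
  moreover have "(\<Sum>j<n. (Matrix.row A j \<bullet> v)\<^sup>2) = ?Hv \<bullet> v"
    using v by (simp add: power2_eq_square flip: sum_rows_scalar_prod)
  ultimately show ?thesis
    by (simp add: parseval[OF Hv v] power2_eq_square mult.assoc)
qed

text \<open>Both sides are the trace of the Gram matrix: Parseval is applied to each row and the
  sums are exchanged.\<close>

lemma frobenius_norm_square: "(frobenius_norm A)\<^sup>2 = (\<Sum>i<d. lam i)"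
proof -
  have "(frobenius_norm A)\<^sup>2 = (\<Sum>j<n. Matrix.row A j \<bullet> Matrix.row A j)"
    using A by (auto simp: frobenius_norm_def sum_nonneg scalar_prod_def lessThan_atLeast0 power2_eq_square
        intro!: sum.cong)
  also have "\<dots> = (\<Sum>i<d. \<Sum>j<n. (Matrix.row A j \<bullet> u i) * (u i \<bullet> Matrix.row A j))"
    unfolding parseval[OF row_carrier row_carrier]
    by (subst sum.swap) (auto intro!: sum.cong simp: comm_scalar_prod[OF u row_carrier])
  also have "\<dots> = (\<Sum>i<d. lam i)"
    by (intro sum.cong refl) (simp add: sum_rows_eigenvector u u_norm)
  finally show ?thesis .
qed

end

section \<open>Propagation of the sampling noise for a consistent system\<close>

locale sampled_consistent_lsq = gram_eigenbasis A n d u lam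
  for A :: "real mat" and n d :: nat and u :: "nat \<Rightarrow> real Matrix.vec" and lam :: "nat \<Rightarrow> real" +
  fixes b xs :: "real Matrix.vec" and p :: "nat pmf" and \<eta> :: real
  assumes xs: "xs \<in> carrier_vec d" and Axs: "A *\<^sub>v xs = b"
    and supp: "set_pmf p = {..<n}"
    and sampling: "\<And>j. j < n \<Longrightarrow> Matrix.row A j \<bullet> Matrix.row A j \<le> \<eta> * pmf p j * (frobenius_norm A)\<^sup>2"
begin

lemma finite_supp: "finite (set_pmf p)"
  by (simp add: supp)

lemma expectation_eq_sum: "measure_pmf.expectation p f = (\<Sum>j<n. pmf p j * f j)" for f :: "nat \<Rightarrow> real"
  by (subst integral_measure_pmf[of "{..<n}"]) (auto simp: supp)

lemma pmf_pos: "j < n \<Longrightarrow> pmf p j > 0"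
  using supp by (simp add: pmf_positive)

lemma vec_index_b: "j < n \<Longrightarrow> vec_index b j = Matrix.row A j \<bullet> xs"
  using A by (auto simp flip: Axs)

text \<open>
  The squared error that the state \<open>z\<close> = (current iterate, previous iterate) leads to after \<open>m\<close> further
  steps without noise.
\<close>
definition predicted_sq :: "real \<Rightarrow> real \<Rightarrow> nat \<Rightarrow> real Matrix.vec \<times> real Matrix.vec \<Rightarrow> real" where
  "predicted_sq \<alpha> \<beta> m z = (\<Sum>i<d.
     (heavy_ball_seq (1 + \<beta> - \<alpha> * lam i) \<beta> (Suc m) * (u i \<bullet> (fst z - xs))
      - \<beta> * heavy_ball_seq (1 + \<beta> - \<alpha> * lam i) \<beta> m * (u i \<bullet> (snd z - xs)))\<^sup>2)"

text \<open>Consistency turns each residual into \<open>Matrix.row A j \<bullet> (x - xs)\<close>,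
  so the noise scales with the error. What remains after centring at \<open>lam i * X\<close> is the
  scalar heavy ball recurrence.\<close>

lemma coordinate_step:
  assumes i: "i < d" and x: "x \<in> carrier_vec d" and y: "y \<in> carrier_vec d"
    and s: "s \<noteq> []" "set s \<subseteq> {..<n}"
  defines "X \<equiv> u i \<bullet> (x - xs)" and "Y \<equiv> u i \<bullet> (y - xs)"
  defines "Z \<equiv> \<lambda>j. 1 / pmf p j * (Matrix.row A j \<bullet> (x - xs)) * (u i \<bullet> Matrix.row A j)"
  shows "u i \<bullet> (fst (hbm_step A b p \<alpha> \<beta> s (x, y)) - xs) =
    (1 + \<beta> - \<alpha> * lam i) * X - \<beta> * Y - \<alpha> / real (length s) * sum_list (map (\<lambda>j. Z j - lam i * X) s)"
proof -
  note bg = batch_grad_carrier[OF A, of b p s x]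
  have Z: "map (\<lambda>j. 1 / pmf p j * (Matrix.row A j \<bullet> x - vec_index b j) * (u i \<bullet> Matrix.row A j)) s = map Z s"
    using s x xs row_carrier
    by (auto simp: Z_def vec_index_b subset_eq scalar_prod_minus_distrib[of _ d])
  have "u i \<bullet> batch_grad A b p s x = 1 / real (length s) * sum_list (map Z s)"
    unfolding scalar_prod_batch_grad[OF A u[OF i]] Z ..
  moreover have "sum_list (map (\<lambda>j. Z j - lam i * X) s) = sum_list (map Z s) - real (length s) * (lam i * X)" for s
    by (induction s) (auto simp: algebra_simps)
  then have "1 / real (length s) * sum_list (map (\<lambda>j. Z j - lam i * X) s) =
      1 / real (length s) * sum_list (map Z s) - lam i * X"
    using s by (simp add: field_simps)
  ultimately have g: "u i \<bullet> batch_grad A b p s x =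
      lam i * X + 1 / real (length s) * sum_list (map (\<lambda>j. Z j - lam i * X) s)" by simp
  have "u i \<bullet> (fst (hbm_step A b p \<alpha> \<beta> s (x, y)) - xs) =
      (u i \<bullet> x - u i \<bullet> xs) - \<alpha> * (u i \<bullet> batch_grad A b p s x) + \<beta> * (u i \<bullet> x - u i \<bullet> y)"
    using u[OF i] x y xs bg
    by (simp add: hbm_step_def scalar_prod_minus_distrib[of _ d] scalar_prod_add_distrib[of _ d])
  also have "\<dots> = X - \<alpha> * (u i \<bullet> batch_grad A b p s x) + \<beta> * (X - Y)"
    using u[OF i] x y xs by (simp add: X_def Y_def scalar_prod_minus_distrib[of _ d])
  finally show ?thesis unfolding g by (simp add: algebra_simps)
qed

text \<open>One noisy update is followed by \<open>m\<close> noiseless ones. The mean part is the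
  prediction with horizon \<open>m + 1\<close>; the centred noise enters through the impulse
  response after \<open>m\<close> steps and is averaged down by the batch.\<close>

lemma expectation_predicted_sq_le:
  assumes x: "x \<in> carrier_vec d" and y: "y \<in> carrier_vec d" and B: "B > 0" and r: "r \<ge> 0"
    and disc: "\<And>i. i < d \<Longrightarrow> (1 + r\<^sup>2 - \<alpha> * lam i)\<^sup>2 \<le> 4 * r\<^sup>2"
    and L: "\<And>i. i < d \<Longrightarrow> lam i \<le> L" and \<eta>: "\<eta> \<ge> 0"
  shows "measure_pmf.expectation (replicate_pmf B p) (\<lambda>s. predicted_sq \<alpha> (r\<^sup>2) m (hbm_step A b p \<alpha> (r\<^sup>2) s (x, y)))
    \<le> predicted_sq \<alpha> (r\<^sup>2) (Suc m) (x, y)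
      + \<alpha>\<^sup>2 * \<eta> * L * (frobenius_norm A)\<^sup>2 / real B * (real (Suc m))\<^sup>2 * (r\<^sup>2) ^ m * predicted_sq \<alpha> (r\<^sup>2) 0 (x, y)"
proof -
  let ?q = "replicate_pmf B p" and ?F = "(frobenius_norm A)\<^sup>2"
  define g where "g i = heavy_ball_seq (1 + r\<^sup>2 - \<alpha> * lam i) (r\<^sup>2)" for i
  define e where "e = x - xs"
  have e: "e \<in> carrier_vec d" using x xs by (simp add: e_def)
  define X where "X i = u i \<bullet> e" for i
  define Y where "Y i = u i \<bullet> (y - xs)" for i
  define Z where "Z i j = 1 / pmf p j * (Matrix.row A j \<bullet> e) * (u i \<bullet> Matrix.row A j)" for i j
  define V where "V i = (\<Sum>j<n. 1 / pmf p j * (Matrix.row A j \<bullet> e)\<^sup>2 * (u i \<bullet> Matrix.row A j)\<^sup>2)" for i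
  \<comment> \<open>The weights of horizon \<open>m\<close>, applied to the noiseless update, become
    those of horizon \<open>m + 1\<close> by the recurrence of
    \<open>heavy_ball_seq\<close>.\<close>
  define w where "w i = g i (Suc (Suc m)) * X i - r\<^sup>2 * g i (Suc m) * Y i" for i
  have fin: "finite (set_pmf ?q)"
    by (rule finite_set_replicate_pmf[OF finite_supp])
  note int = integrable_measure_pmf_finite[OF fin]
  have coord: "measure_pmf.expectation ?q (\<lambda>s. (g i (Suc m) * (u i \<bullet> (fst (hbm_step A b p \<alpha> (r\<^sup>2) s (x, y)) - xs)) - r\<^sup>2 * g i m * X i)\<^sup>2)
      \<le> (w i)\<^sup>2 + \<alpha>\<^sup>2 / real B * (real (Suc m))\<^sup>2 * (r\<^sup>2) ^ m * V i" if i: "i < d" for i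
  proof -
    \<comment> \<open>The factor with which one centred draw enters the predicted
      coordinate.\<close>
    define \<gamma> where "\<gamma> = - (\<alpha> * g i (Suc m) / real B)"
    let ?W = "\<lambda>j. \<gamma> * (Z i j - lam i * X i)"
    have mean: "measure_pmf.expectation p (Z i) = lam i * X i"
    proof -
      have "measure_pmf.expectation p (Z i) = (\<Sum>j<n. (Matrix.row A j \<bullet> e) * (u i \<bullet> Matrix.row A j))"
        unfolding expectation_eq_sum by (intro sum.cong) (auto simp: Z_def dest: pmf_pos)
      then show ?thesis using i e by (simp add: sum_rows_eigenvector X_def)
    qed
    have second: "measure_pmf.expectation p (\<lambda>j. (Z i j)\<^sup>2) = V i"
      unfolding expectation_eq_sum V_def
      by (intro sum.cong) (auto simp: Z_def power2_eq_square dest: pmf_pos)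
    note intp = integrable_measure_pmf_finite[OF finite_supp]
    have meanW: "measure_pmf.expectation p ?W = 0"
      by (simp add: intp mean)
    have "measure_pmf.variance p (Z i) \<le> V i"
      by (subst measure_pmf.variance_eq) (use second in \<open>simp_all add: intp\<close>)
    then have var: "measure_pmf.expectation p (\<lambda>j. (?W j)\<^sup>2) \<le> \<gamma>\<^sup>2 * V i"
      by (simp add: mean power_mult_distrib mult_left_mono)
    have V0: "V i \<ge> 0" by (auto simp: V_def intro!: sum_nonneg)
    have "measure_pmf.expectation ?q (\<lambda>s. (g i (Suc m) * (u i \<bullet> (fst (hbm_step A b p \<alpha> (r\<^sup>2) s (x, y)) - xs)) - r\<^sup>2 * g i m * X i)\<^sup>2)
        = measure_pmf.expectation ?q (\<lambda>s. (w i + sum_list (map ?W s))\<^sup>2)"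
    proof (intro integral_cong_AE AE_pmfI, simp_all)
      fix s assume "s \<in> set_pmf ?q"
      then have len: "length s = B" and sub: "set s \<subseteq> {..<n}" by (auto simp: set_replicate_pmf supp)
      have step: "u i \<bullet> (fst (hbm_step A b p \<alpha> (r\<^sup>2) s (x, y)) - xs) =
        (1 + r\<^sup>2 - \<alpha> * lam i) * X i - r\<^sup>2 * Y i - \<alpha> / real B * sum_list (map (\<lambda>j. Z i j - lam i * X i) s)"
        unfolding X_def Y_def Z_def e_def len[symmetric]
        by (rule coordinate_step[OF i x y _ sub]) (use len B in auto)
      have "sum_list (map ?W s) = \<gamma> * sum_list (map (\<lambda>j. Z i j - lam i * X i) s)"
        by (rule sum_list_const_mult)
      then show "(g i (Suc m) * (u i \<bullet> (fst (hbm_step A b p \<alpha> (r\<^sup>2) s (x, y)) - xs)) - r\<^sup>2 * g i m * X i)\<^sup>2 =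
          (w i + sum_list (map ?W s))\<^sup>2"
        unfolding step by (simp add: w_def g_def \<gamma>_def algebra_simps)
    qed
    also have "\<dots> = (w i)\<^sup>2 + real B * measure_pmf.expectation p (\<lambda>j. (?W j)\<^sup>2)"
      by (rule expectation_replicate_pmf_square[OF finite_supp meanW])
    also have "\<dots> \<le> (w i)\<^sup>2 + real B * (\<gamma>\<^sup>2 * V i)"
      using var by (intro add_left_mono mult_left_mono) auto
    also have "real B * (\<gamma>\<^sup>2 * V i) = \<alpha>\<^sup>2 / real B * V i * (g i (Suc m))\<^sup>2"
      using B by (simp add: \<gamma>_def power2_eq_square)
    also have "\<dots> \<le> \<alpha>\<^sup>2 / real B * V i * (real (Suc m) * r ^ m)\<^sup>2"
      using V0 abs_heavy_ball_seq_Suc_le[OF r disc[OF i], of m]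
      by (intro mult_left_mono) (auto simp: g_def abs_le_square_iff[symmetric] r)
    finally show ?thesis by (simp add: power_mult_distrib power_mult[symmetric] mult_ac)
  qed
  have sumV: "(\<Sum>i<d. V i) \<le> \<eta> * ?F * L * (\<Sum>i<d. (X i)\<^sup>2)"
  proof -
    \<comment> \<open>Parseval turns the squared coordinates of a row into its squared norm. The
      sampling hypothesis then trades that norm for a multiple of \<open>pmf p j\<close>, which
      cancels the importance weight.\<close>
    have "(\<Sum>i<d. V i) = (\<Sum>j<n. 1 / pmf p j * (Matrix.row A j \<bullet> e)\<^sup>2 * (Matrix.row A j \<bullet> Matrix.row A j))"
      unfolding V_def parseval[OF row_carrier row_carrier]
      by (subst sum.swap) (simp add: sum_distrib_left power2_eq_square)
    also have "\<dots> \<le> (\<Sum>j<n. 1 / pmf p j * (Matrix.row A j \<bullet> e)\<^sup>2 * (\<eta> * pmf p j * ?F))"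
      using sampling by (intro sum_mono mult_left_mono) auto
    also have "\<dots> = \<eta> * ?F * (\<Sum>j<n. (Matrix.row A j \<bullet> e)\<^sup>2)"
      unfolding sum_distrib_left by (intro sum.cong) (auto dest: pmf_pos)
    also have "\<dots> = \<eta> * ?F * (\<Sum>i<d. lam i * (X i)\<^sup>2)"
      using e by (simp add: sum_rows_square X_def)
    also have "\<dots> \<le> \<eta> * ?F * (\<Sum>i<d. L * (X i)\<^sup>2)"
      using \<eta> L by (intro mult_left_mono sum_mono mult_right_mono) auto
    finally show ?thesis by (simp add: mult.assoc flip: sum_distrib_left)
  qed
  have "measure_pmf.expectation ?q (\<lambda>s. predicted_sq \<alpha> (r\<^sup>2) m (hbm_step A b p \<alpha> (r\<^sup>2) s (x, y)))
      = (\<Sum>i<d. measure_pmf.expectation ?q (\<lambda>s. (g i (Suc m) * (u i \<bullet> (fst (hbm_step A b p \<alpha> (r\<^sup>2) s (x, y)) - xs)) - r\<^sup>2 * g i m * X i)\<^sup>2))"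
    unfolding predicted_sq_def by (simp add: int g_def X_def e_def hbm_step_def)
  also have "\<dots> \<le> (\<Sum>i<d. (w i)\<^sup>2 + \<alpha>\<^sup>2 / real B * (real (Suc m))\<^sup>2 * (r\<^sup>2) ^ m * V i)"
    using coord by (intro sum_mono) auto
  also have "\<dots> = (\<Sum>i<d. (w i)\<^sup>2) + \<alpha>\<^sup>2 / real B * (real (Suc m))\<^sup>2 * (r\<^sup>2) ^ m * (\<Sum>i<d. V i)"
    by (simp add: sum.distrib sum_distrib_left)
  also have "\<dots> \<le> (\<Sum>i<d. (w i)\<^sup>2) + \<alpha>\<^sup>2 / real B * (real (Suc m))\<^sup>2 * (r\<^sup>2) ^ m * (\<eta> * ?F * L * (\<Sum>i<d. (X i)\<^sup>2))"
    using sumV by (intro add_left_mono mult_left_mono) auto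
  also have "(\<Sum>i<d. (w i)\<^sup>2) = predicted_sq \<alpha> (r\<^sup>2) (Suc m) (x, y)"
    by (simp add: predicted_sq_def w_def g_def X_def Y_def e_def)
  also have "(\<Sum>i<d. (X i)\<^sup>2) = predicted_sq \<alpha> (r\<^sup>2) 0 (x, y)"
    by (simp add: predicted_sq_def X_def e_def)
  finally show ?thesis by (simp add: mult_ac)
qed

text \<open>At horizon 0 the weights are 1 and 0, so Parseval yields the current squared
  error.\<close>

lemma predicted_sq_0:
  assumes "x \<in> carrier_vec d"
  shows "predicted_sq \<alpha> \<beta> 0 (x, y) = (euclid_norm (x - xs))\<^sup>2"
proof -
  have "(x - xs) \<bullet> (x - xs) = (\<Sum>i<d. (u i \<bullet> (x - xs))\<^sup>2)"
    using parseval[of "x - xs" "x - xs"] assms xs by (simp add: power2_eq_square)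
  then show ?thesis by (simp add: predicted_sq_def euclid_norm_def sum_nonneg)
qed

text \<open>The mean of \<open>predicted_sq\<close> with horizon \<open>m\<close> after
  \<open>k\<close> updates obeys the recurrence of \<open>noisy_recurrence_bound\<close>, and
  horizon 0 is the true mean square error.\<close>

lemma hbm_mean_square_le:
  assumes x0: "x0 \<in> carrier_vec d" and B: "B > 0" and r: "0 \<le> r" "r < \<rho>" "\<rho> \<le> 1"
    and disc: "\<And>i. i < d \<Longrightarrow> (1 + r\<^sup>2 - \<alpha> * lam i)\<^sup>2 \<le> 4 * r\<^sup>2"
    and L: "\<And>i. i < d \<Longrightarrow> lam i \<le> L" "L \<ge> 0" and \<eta>: "\<eta> \<ge> 0"
    and small: "\<alpha>\<^sup>2 * \<eta> * L * (frobenius_norm A)\<^sup>2 / real B / \<rho>\<^sup>2 * (2 / (1 - r\<^sup>2 / \<rho>\<^sup>2) ^ 3) \<le> 1 / 2"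
  shows "(\<integral>S. (euclid_norm (hbm A b p \<alpha> (r\<^sup>2) x0 S (Suc k) - xs))\<^sup>2 \<partial>batches B p)
    \<le> 16 / (1 - r\<^sup>2 / \<rho>\<^sup>2) ^ 3 * (euclid_norm (x0 - xs))\<^sup>2 * (\<rho>\<^sup>2) ^ k"
proof -
  let ?q = "replicate_pmf B p" and ?T = "hbm_step A b p \<alpha> (r\<^sup>2)" and ?\<Phi> = "predicted_sq \<alpha> (r\<^sup>2)"
  let ?E = "(euclid_norm (x0 - xs))\<^sup>2"
  define I where "I = (carrier_vec d \<times> carrier_vec d :: (real Matrix.vec \<times> real Matrix.vec) set)"
  define \<tau> where "\<tau> = \<alpha>\<^sup>2 * \<eta> * L * (frobenius_norm A)\<^sup>2 / real B"
  define M where "M m k = mean_after ?q ?T k (?\<Phi> m) (x0, x0)" for m k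
  have fin: "finite (set_pmf ?q)"
    by (rule finite_set_replicate_pmf[OF finite_supp])
  have inv: "?T s z \<in> I" if "z \<in> I" for s z
    using that batch_grad_carrier[OF A] by (auto simp: I_def hbm_step_def)
  have "(\<integral>S. (euclid_norm (hbm A b p \<alpha> (r\<^sup>2) x0 S (Suc k) - xs))\<^sup>2 \<partial>batches B p)
      = mean_after ?q ?T k (\<lambda>z. (euclid_norm (fst z - xs))\<^sup>2) (x0, x0)"
    by (rule hbm_expectation[OF finite_supp])
  also have "\<dots> = M 0 k"
  proof -
    have "mean_after ?q ?T k (\<lambda>z. (euclid_norm (fst z - xs))\<^sup>2) z = mean_after ?q ?T k (?\<Phi> 0) z" if "z \<in> I" for z
      using that
    proof (induction k arbitrary: z)
      case 0
      then show ?case by (cases z) (simp add: predicted_sq_0 I_def)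
    qed (simp add: inv)
    then show ?thesis using x0 by (simp add: I_def M_def)
  qed
  also have "M 0 k \<le> 16 / (1 - r\<^sup>2 / \<rho>\<^sup>2) ^ 3 * ?E * (\<rho>\<^sup>2) ^ k"
  proof (rule noisy_recurrence_bound[of r \<rho> \<tau> M])
    show "M m (Suc j) \<le> M (Suc m) j + \<tau> * (real (Suc m))\<^sup>2 * (r\<^sup>2) ^ m * M 0 j" for m j
      unfolding M_def
    proof (rule mean_after_Suc_le[OF fin, where I = I])
      fix z assume z: "z \<in> I"
      show "measure_pmf.expectation ?q (\<lambda>s. ?\<Phi> m (?T s z)) \<le> ?\<Phi> (Suc m) z + \<tau> * (real (Suc m))\<^sup>2 * (r\<^sup>2) ^ m * ?\<Phi> 0 z"
        using expectation_predicted_sq_le[OF _ _ B r(1) disc L(1) \<eta>, of "fst z" "snd z" m] z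
        by (auto simp: I_def \<tau>_def)
    qed (use inv x0 in \<open>auto simp: I_def\<close>)
    show "M m 0 \<le> 4 * (real (Suc m))\<^sup>2 * (r\<^sup>2) ^ m * ?E" for m
    proof -
      let ?g = "\<lambda>i. heavy_ball_seq (1 + r\<^sup>2 - \<alpha> * lam i) (r\<^sup>2)"
      \<comment> \<open>As the two initial iterates are equal, the initial coordinate factors out of
        both terms.\<close>
      have "M m 0 = (\<Sum>i<d. (?g i (Suc m) - r\<^sup>2 * ?g i m)\<^sup>2 * (u i \<bullet> (x0 - xs))\<^sup>2)"
        by (simp add: M_def predicted_sq_def power_mult_distrib[symmetric] left_diff_distrib)
      also have "\<dots> \<le> (\<Sum>i<d. (4 * (real (Suc m))\<^sup>2 * (r\<^sup>2) ^ m) * (u i \<bullet> (x0 - xs))\<^sup>2)"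
        using r by (intro sum_mono mult_right_mono heavy_ball_seq_initial_bound disc) auto
      also have "\<dots> = 4 * (real (Suc m))\<^sup>2 * (r\<^sup>2) ^ m * ?\<Phi> 0 (x0, x0)"
        by (simp add: predicted_sq_def sum_distrib_left)
      finally show ?thesis using x0 by (simp add: predicted_sq_0)
    qed
  qed (use r small \<eta> L in \<open>auto simp: \<tau>_def\<close>)
  finally show ?thesis .
qed

text \<open>The second moment controls the mean because a variance is nonnegative. The division by
  \<open>\<rho>\<close> accounts for iterate \<open>k\<close> being reached after
  \<open>k - 1\<close> updates.\<close>

lemma hbm_mean_error_le:
  assumes x0: "x0 \<in> carrier_vec d" and B: "B > 0" and r: "0 \<le> r" "r < \<rho>" "\<rho> \<le> 1"
    and disc: "\<And>i. i < d \<Longrightarrow> (1 + r\<^sup>2 - \<alpha> * lam i)\<^sup>2 \<le> 4 * r\<^sup>2"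
    and L: "\<And>i. i < d \<Longrightarrow> lam i \<le> L" "L \<ge> 0" and \<eta>: "\<eta> \<ge> 0"
    and small: "\<alpha>\<^sup>2 * \<eta> * L * (frobenius_norm A)\<^sup>2 / real B / \<rho>\<^sup>2 * (2 / (1 - r\<^sup>2 / \<rho>\<^sup>2) ^ 3) \<le> 1 / 2"
    and k: "k > 0"
  shows "(\<integral>S. euclid_norm (hbm A b p \<alpha> (r\<^sup>2) x0 S k - xs) \<partial>batches B p)
    \<le> sqrt (16 / (1 - r\<^sup>2 / \<rho>\<^sup>2) ^ 3) / \<rho> * \<rho> ^ k * euclid_norm (x0 - xs)"
proof -
  obtain l where l: "k = Suc l" using k by (cases k) auto
  let ?X = "\<lambda>S. euclid_norm (hbm A b p \<alpha> (r\<^sup>2) x0 S k - xs)"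
  define N where "N = 16 / (1 - r\<^sup>2 / \<rho>\<^sup>2) ^ 3"
  interpret P: prob_space "batches B p"
    unfolding batches_def by (intro prob_space_PiM prob_space_measure_pmf)
  have "(P.expectation ?X)\<^sup>2 \<le> P.expectation (\<lambda>S. (?X S)\<^sup>2)"
    using P.variance_eq[of ?X] P.variance_positive[of ?X]
      integrable_hbm[OF finite_supp, of B "\<lambda>v. euclid_norm (v - xs)"]
      integrable_hbm[OF finite_supp, of B "\<lambda>v. (euclid_norm (v - xs))\<^sup>2"] by simp
  also have "\<dots> \<le> N * (euclid_norm (x0 - xs))\<^sup>2 * (\<rho>\<^sup>2) ^ l"
    unfolding N_def l by (rule hbm_mean_square_le[OF x0 B r disc L \<eta> small])
  finally have "\<bar>P.expectation ?X\<bar> \<le> sqrt (N * (euclid_norm (x0 - xs))\<^sup>2 * (\<rho>\<^sup>2) ^ l)"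
    using real_le_rsqrt real_sqrt_abs real_sqrt_le_iff by metis
  moreover have "euclid_norm (x0 - xs) \<ge> 0" 
    by (simp add: euclid_norm_def scalar_prod_def sum_nonneg)
  then have "sqrt (N * (euclid_norm (x0 - xs))\<^sup>2 * (\<rho>\<^sup>2) ^ l) = sqrt N * euclid_norm (x0 - xs) * \<rho> ^ l"
    using r by (simp add: real_sqrt_mult real_sqrt_power)
  moreover have "sqrt N * euclid_norm (x0 - xs) * \<rho> ^ l = sqrt N / \<rho> * \<rho> ^ k * euclid_norm (x0 - xs)"
    using r by (simp add: l)
  ultimately show ?thesis by (simp add: N_def)
qed

end

subsection \<open>Choice of the parameters\<close>

theorem corollary3p4:
  fixes c :: real
  assumes "0 < c" and "c < 2"
  shows "\<exists>C > 0. \<exists>\<kappa>\<^sub>0 > 1.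
    \<forall>(n :: nat) (d :: nat) (A :: real mat) (b :: real Matrix.vec) (xs :: real Matrix.vec)
      (p :: nat pmf) (\<eta> :: real).
      0 < n \<and> 0 < d \<and> A \<in> carrier_mat n d \<and> lambda_min A > 0 \<and> cond_num A \<ge> \<kappa>\<^sub>0 \<and>
      b \<in> carrier_vec n \<and>
      is_arg_min (lsq A b) (\<lambda>x. x \<in> carrier_vec d) xs \<and> A *\<^sub>v xs = b \<and>
      set_pmf p = {..<n} \<and>
      \<eta> \<ge> 1 \<and>
      (\<forall>j<n. \<eta> * pmf p j \<ge> (euclid_norm (Matrix.row A j))\<^sup>2 / (frobenius_norm A)\<^sup>2)
      \<longrightarrow>
      (\<exists>\<alpha> \<beta> :: real. \<forall>B :: nat.
        real B \<ge> C * \<eta> * real d * ln (real d) * ave_cond_num A * sqrt (cond_num A) \<longrightarrow>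
        (\<exists>K :: real. \<forall>x0 \<in> carrier_vec d. \<forall>k > 0.
          (\<integral>S. euclid_norm (hbm A b p \<alpha> \<beta> x0 S k - xs) \<partial>batches B p)
          \<le> K * (1 - c / sqrt (cond_num A)) ^ k * euclid_norm (x0 - xs)))"
proof -
  \<comment> \<open>The distance from \<open>1 + c / 2\<close>, the midpoint of \<open>c\<close> and
    2, to either end. One half of the room below 2 keeps the roots complex, the other separates
    \<open>r\<close> from \<open>\<rho>\<close>.\<close>
  define \<delta> where "\<delta> = 1 - c / 2"
  have \<delta>: "0 < \<delta>" "\<delta> < 1" using assms by (auto simp: \<delta>_def)
  have \<delta>4: "4 < 4 / \<delta>" using \<delta> by (simp add: field_simps)
  have \<kappa>0: "1 < (4 / \<delta>)\<^sup>2" using \<delta>4 by (intro one_less_power) auto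
  show ?thesis
  \<comment> \<open>The noise bound below requires a batch of size \<open>256 * Q\<close>, and 512
    makes up for \<open>ln (real d)\<close> being bounded below by one half only. The threshold on
    the condition number yields \<open>4 \<le> s * \<delta>\<close>.\<close>
  proof (rule exI[of _ "512 / \<delta> ^ 3"], rule conjI, use \<delta> in simp,
      rule exI[of _ "(4 / \<delta>)\<^sup>2"], rule conjI, rule \<kappa>0, intro allI impI, elim conjE)
    fix n d :: nat and A :: "real mat" and b xs :: "real Matrix.vec" and p :: "nat pmf" and \<eta> :: real
    assume d: "0 < d" and A: "A \<in> carrier_mat n d" and min_pos: "lambda_min A > 0"
      and \<kappa>: "cond_num A \<ge> (4 / \<delta>)\<^sup>2"
      and xs: "is_arg_min (lsq A b) (\<lambda>x. x \<in> carrier_vec d) xs" "A *\<^sub>v xs = b"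
      and supp: "set_pmf p = {..<n}" and \<eta>: "\<eta> \<ge> 1"
      and sampling: "\<forall>j<n. \<eta> * pmf p j \<ge> (euclid_norm (Matrix.row A j))\<^sup>2 / (frobenius_norm A)\<^sup>2"
    let ?H = "transpose_mat A * A" and ?F = "(frobenius_norm A)\<^sup>2"
    have H: "?H \<in> carrier_mat d d" using A by simp
    have sym: "transpose_mat ?H = ?H" using A by (simp add: transpose_mult[of _ d n])
    obtain u lam where
      basis: "\<And>i. i < d \<Longrightarrow> u i \<in> carrier_vec d" "\<And>i. i < d \<Longrightarrow> u i \<bullet> u i = 1"
        "\<And>i. i < d \<Longrightarrow> ?H *\<^sub>v u i = lam i \<cdot>\<^sub>v u i"
        "\<And>v w. v \<in> carrier_vec d \<Longrightarrow> w \<in> carrier_vec d \<Longrightarrow> v \<bullet> w = (\<Sum>i<d. (u i \<bullet> v) * (u i \<bullet> w))"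
      and eig: "proots (char_poly ?H) = image_mset lam (mset_set {..<d})"
      by (rule real_symmetric_eigenbasis[OF H sym]) (rule that)
    have gram: "gram_eigenvalues A = image_mset lam (mset_set {..<d})"
      using eig by (simp add: gram_eigenvalues_def)
    define \<mu> where "\<mu> = lambda_min A"
    define L where "L = lambda_max A"
    have lam: "\<mu> \<le> lam i" "lam i \<le> L" if "i < d" for i
      using that by (auto simp: \<mu>_def L_def lambda_min_def lambda_max_def gram)
    have \<mu>: "0 < \<mu>" using min_pos by (simp add: \<mu>_def)
    have L: "0 < L" using lam[of 0] \<mu> d by simp
    \<comment> \<open>For \<open>d = 1\<close> the logarithm would be 0 and the hypothesis on
      \<open>B\<close> empty, but a single eigenvalue has condition number 1, below the
      threshold.\<close>
    have "d \<noteq> 1"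
    proof
      assume "d = 1"
      then have "cond_num A = 1"
        using \<mu> by (simp add: cond_num_def lambda_min_def lambda_max_def gram \<mu>_def lessThan_Suc)
      then show False using \<kappa> \<kappa>0 by simp
    qed
    then have "exp (1 / 2) \<le> real d"
      using d exp_half_le2 by simp
    then have ln_d: "1 / 2 \<le> ln (real d)" using d by (subst ln_ge_iff) auto

    interpret gram_eigenbasis A n d u lam
      by unfold_locales (fact A basis)+
    \<comment> \<open>This is how the dimension and the average condition number enter the batch
      size.\<close>
    have F: "?F = real d * lambda_ave A"
      using d A by (simp add: frobenius_norm_square lambda_ave_def gram flip: sum_unfold_sum_mset)
    have F_pos: "0 < ?F"
      unfolding frobenius_norm_square using lam(1) \<mu> d by (intro sum_pos) force+
    interpret sampled_consistent_lsq A n d u lam b xs p \<eta>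
    proof
      show "xs \<in> carrier_vec d" using xs(1) by (simp add: is_arg_min_def)
      show "Matrix.row A j \<bullet> Matrix.row A j \<le> \<eta> * pmf p j * ?F" if "j < n" for j
      proof -
        have "(euclid_norm (Matrix.row A j))\<^sup>2 = Matrix.row A j \<bullet> Matrix.row A j"
          by (simp add: euclid_norm_def scalar_prod_def sum_nonneg)
        moreover have "(euclid_norm (Matrix.row A j))\<^sup>2 \<le> \<eta> * pmf p j * ?F"
          using sampling that F_pos by (simp add: divide_le_eq)
        ultimately show ?thesis by simp
      qed
    qed (use xs supp in auto)

    define s where "s = sqrt (cond_num A)"
    have le_s: "4 / \<delta> \<le> s" unfolding s_def using \<kappa> by (rule real_le_rsqrt)
    have s4: "4 < s" using le_s \<delta>4 by linarith
    have s\<delta>: "4 \<le> s * \<delta>" using le_s \<delta> by (simp only: pos_divide_le_eq)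
    have "cond_num A \<ge> 0" using order.trans[OF zero_le_power2 \<kappa>] .
    then have s2: "s\<^sup>2 = L / \<mu>" by (simp add: s_def cond_num_def L_def \<mu>_def)
    define c' where "c' = 1 + c / 2"
    have c': "1 < c'" "c' < 2" "c' - c = \<delta>" "c' = 2 - \<delta>" using assms by (auto simp: c'_def \<delta>_def)
    define r where "r = 1 - c' / s"
    define \<rho> where "\<rho> = 1 - c / s"
    \<comment> \<open>Chosen such that \<open>(1 - r)\<^sup>2 = \<alpha> * \<mu>\<close>: the
      smallest eigenvalue gives a double root.\<close>
    define \<alpha> where "\<alpha> = c'\<^sup>2 / L"
    have gap: "\<rho> - r = \<delta> / s" by (simp add: \<rho>_def r_def diff_divide_distrib flip: c'(3))
    have r: "1 / 2 \<le> r" using c' s4 by (simp add: r_def field_simps)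
    have "0 < \<delta> / s" using \<delta> s4 by simp
    then have r\<rho>: "r < \<rho>" using gap by simp
    have \<rho>1: "\<rho> \<le> 1" using assms s4 by (simp add: \<rho>_def)
    \<comment> \<open>The claim amounts to \<open>\<alpha> * lam i\<close> lying between
      \<open>(1 - r)\<^sup>2\<close> and \<open>(1 + r)\<^sup>2\<close>. The upper bound reduces to
      \<open>c' \<le> 1 + r\<close>, which holds since \<open>s\<close> is large.\<close>
    have disc: "(1 + r\<^sup>2 - \<alpha> * lam i)\<^sup>2 \<le> 4 * r\<^sup>2" if i: "i < d" for i
    proof -
      have "(1 - r)\<^sup>2 = \<alpha> * \<mu>"
        using L \<mu> s4 s2 by (simp add: r_def \<alpha>_def power_divide)
      then have lo: "(1 - r)\<^sup>2 \<le> \<alpha> * lam i"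
        using lam(1)[OF i] L by (simp add: \<alpha>_def mult_left_mono divide_right_mono)
      have "c' \<le> \<delta> * s" using c'(2) s\<delta> by (simp add: mult.commute)
      then have "c' / s \<le> \<delta>" using s4 by (simp only: pos_divide_le_eq)
      then have "c' \<le> 1 + r" using c' by (simp add: r_def)
      then have "c'\<^sup>2 \<le> (1 + r)\<^sup>2" using c' by (intro power_mono) auto
      moreover have "\<alpha> * lam i \<le> \<alpha> * L" using lam(2)[OF i] L by (intro mult_left_mono) (auto simp: \<alpha>_def)
      ultimately have hi: "\<alpha> * lam i \<le> (1 + r)\<^sup>2" using L by (simp add: \<alpha>_def)
      have "\<bar>1 + r\<^sup>2 - \<alpha> * lam i\<bar> \<le> 2 * r"
        using lo hi by (simp add: power2_eq_square algebra_simps abs_le_iff)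
      then have "\<bar>1 + r\<^sup>2 - \<alpha> * lam i\<bar>\<^sup>2 \<le> (2 * r)\<^sup>2" by (intro power_mono) auto
      then show ?thesis by (simp add: power_mult_distrib)
    qed

    show "\<exists>\<alpha> \<beta>. \<forall>B. 512 / \<delta> ^ 3 * \<eta> * real d * ln (real d) * ave_cond_num A * sqrt (cond_num A) \<le> real B \<longrightarrow>
        (\<exists>K. \<forall>x0\<in>carrier_vec d. \<forall>k>0.
          (\<integral>S. euclid_norm (hbm A b p \<alpha> \<beta> x0 S k - xs) \<partial>batches B p)
          \<le> K * (1 - c / sqrt (cond_num A)) ^ k * euclid_norm (x0 - xs))"
    \<comment> \<open>Neither witness depends on \<open>B\<close>, as the order of the quantifiers
      demands.\<close>
    proof (rule exI[of _ \<alpha>], rule exI[of _ "r\<^sup>2"], intro allI impI)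
      fix B :: nat
      assume B: "512 / \<delta> ^ 3 * \<eta> * real d * ln (real d) * ave_cond_num A * sqrt (cond_num A) \<le> real B"
      define Q where "Q = \<eta> * (?F / \<mu>) * s / \<delta> ^ 3"
      have Q: "0 < Q" using \<eta> F_pos \<mu> s4 \<delta> by (simp add: Q_def)
      have "512 * Q * (1 / 2) \<le> 512 * Q * ln (real d)"
        using Q ln_d by (intro mult_left_mono) auto
      also have "\<dots> \<le> real B"
        using B by (simp add: Q_def F ave_cond_num_def \<mu>_def s_def mult_ac)
      finally have BQ: "256 * Q \<le> real B" by simp
      then have B0: "B > 0" using Q by (cases B) auto
      \<comment> \<open>Factoring \<open>\<rho>\<^sup>2 - r\<^sup>2\<close> shows that the
        discounted kernel has ratio at most \<open>1 - \<delta> / s\<close>, hence mass of order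
        \<open>s ^ 3\<close>.\<close>
      have q: "\<delta> / s \<le> 1 - r\<^sup>2 / \<rho>\<^sup>2"
      proof -
        have "\<delta> / s * 1 \<le> (\<rho> - r) * (\<rho> + r)"
          using r r\<rho> \<open>0 < \<delta> / s\<close> unfolding gap by (intro mult_left_mono) auto
        also have "\<dots> = \<rho>\<^sup>2 - r\<^sup>2" by (simp add: power2_eq_square algebra_simps)
        also have "\<dots> \<le> (\<rho>\<^sup>2 - r\<^sup>2) / \<rho>\<^sup>2"
        proof -
          have "\<rho>\<^sup>2 \<le> 1" "0 < \<rho>\<^sup>2" using r r\<rho> \<rho>1 by (auto simp: power_le_one)
          moreover have "r\<^sup>2 \<le> \<rho>\<^sup>2" using r r\<rho> by (intro power_mono) auto
          ultimately show ?thesis by (simp add: divide_simps mult_left_le)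
        qed
        also have "\<dots> = 1 - r\<^sup>2 / \<rho>\<^sup>2" using r r\<rho> by (simp add: diff_divide_distrib)
        finally show ?thesis by simp
      qed
      have "2 / (1 - r\<^sup>2 / \<rho>\<^sup>2) ^ 3 \<le> 2 / (\<delta> / s) ^ 3"
        using q \<open>0 < \<delta> / s\<close> by (intro divide_left_mono power_mono mult_pos_pos zero_less_power) auto
      moreover have "1 / \<rho>\<^sup>2 \<le> 4"
      proof -
        have "(1 / 2)\<^sup>2 \<le> \<rho>\<^sup>2" using r r\<rho> by (intro power_mono) auto
        then show ?thesis using r r\<rho> by (simp add: field_simps power2_eq_square)
      qed
      moreover have "\<alpha>\<^sup>2 * \<eta> * L * ?F / real B \<le> 16 / L * \<eta> * ?F / real B"
      proof -
        have "c' ^ 4 \<le> 2 ^ 4" using c' by (intro power_mono) auto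
        then have "\<alpha>\<^sup>2 * L \<le> 16 / L"
          using L by (simp add: \<alpha>_def power2_eq_square field_simps eval_nat_numeral)
        then have "\<alpha>\<^sup>2 * L * (\<eta> * ?F / real B) \<le> 16 / L * (\<eta> * ?F / real B)"
          using \<eta> by (intro mult_right_mono) auto
        then show ?thesis by (simp add: mult_ac)
      qed
      ultimately have "\<alpha>\<^sup>2 * \<eta> * L * ?F / real B * (1 / \<rho>\<^sup>2) * (2 / (1 - r\<^sup>2 / \<rho>\<^sup>2) ^ 3)
          \<le> 16 / L * \<eta> * ?F / real B * 4 * (2 / (\<delta> / s) ^ 3)"
        using \<eta> L q \<open>0 < \<delta> / s\<close> by (intro mult_mono) auto
      \<comment> \<open>128 is the product of 16 from \<open>c' ^ 4\<close>, 4 from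
        \<open>1 / \<rho>\<^sup>2\<close> and 2 from the kernel mass; \<open>s ^ 3 / L\<close>
        reduces to \<open>s / \<mu>\<close>.\<close>
      also have "\<dots> = 128 * Q / real B"
      proof -
        have "s ^ 3 = L / \<mu> * s" using s2 by (simp add: power3_eq_cube power2_eq_square)
        then show ?thesis using L \<delta> by (simp add: Q_def power_divide field_simps)
      qed
      also have "\<dots> \<le> 1 / 2" using BQ B0 by (simp add: field_simps)
      finally have small: "\<alpha>\<^sup>2 * \<eta> * L * ?F / real B / \<rho>\<^sup>2 * (2 / (1 - r\<^sup>2 / \<rho>\<^sup>2) ^ 3) \<le> 1 / 2"
        by simp
      show "\<exists>K. \<forall>x0\<in>carrier_vec d. \<forall>k>0.
          (\<integral>S. euclid_norm (hbm A b p \<alpha> (r\<^sup>2) x0 S k - xs) \<partial>batches B p)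
          \<le> K * (1 - c / sqrt (cond_num A)) ^ k * euclid_norm (x0 - xs)"
        using hbm_mean_error_le[OF _ B0 _ r\<rho> \<rho>1 disc lam(2) _ _ small] r L \<eta>
        by (intro exI[of _ "sqrt (16 / (1 - r\<^sup>2 / \<rho>\<^sup>2) ^ 3) / \<rho>"]) (auto simp: \<rho>_def s_def)
    qed
  qed
qed

end
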